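(* Call a packing of unit balls in $\mathbb{R}^4$ a single-deviation packing if at every one of its centres at most one active neighbour direction fails to be a root direction of the $D_4$ root system $R$. Every periodic single-deviation packing has density at most $\pi^2/16$, with equality for the $D_4$ lattice $\sqrt2\,D_4$; and every (not necessarily periodic) single-deviation packing also has density at most $\pi^2/16$.
   Context: A unit-ball packing of $\mathbb{R}^4$ is given by its centre set $\mathcal{C}\subset\mathbb{R}^4$, with $|c-c'|\ge 2$ for distinct $c,c'\in\mathcal{C}$. It is periodic if $\mathcal{C}$ is invariant under translation by a full-rank lattice. The active neighbours of $c$ are the centres $y\in\mathcal{C}\setminus\{c\}$ with $|y-c|<2\sqrt2$; the direction of $y$ is $(y-c)/|y-c|$. $R=\{\pm e_i\pm e_j:1\le i<j\le4\}$ is the $D_4$ root system; a root direction is $\alpha/\sqrt2$ with $\alpha\in R$. $D_4=\{m\in\mathbb{Z}^4: m_1+m_2+m_3+m_4\text{ even}\}$, so $\sqrt2\,D_4$ has nearest-neighbour distance $2$. The density of a packing is $$\delta(\mathcal{C})=\limsup_{\rho\to\infty}\frac{\mathrm{vol}(B^4)\cdot\#\{c\in\mathcal{C}:|c|\le \rho\}}{\mathrm{vol}(B^4_\rho)},$$ where $B^4_\rho$ is the ball of radius $\rho$ about the origin and $B^4=B^4_1$. *)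

theory Defs
  imports "HOL-Analysis.Analysis"
begin

text \<open>A packing of unit balls is represented by its set of centres.\<close>

definition unit_ball_packing :: "(real^4) set \<Rightarrow> bool" where
  "unit_ball_packing C \<longleftrightarrow> (\<forall>c\<in>C. \<forall>c'\<in>C. c \<noteq> c' \<longrightarrow> norm (c - c') \<ge> 2)"

definition full_rank_lattice :: "(real^4) set \<Rightarrow> bool" where
  "full_rank_lattice L \<longleftrightarrow>
     (\<exists>B. independent B \<and> span B = UNIV \<and>
          L = {\<Sum>b\<in>B. of_int (k b) *\<^sub>R b | k :: real^4 \<Rightarrow> int. True})"

definition periodic :: "(real^4) set \<Rightarrow> bool" where
  "periodic C \<longleftrightarrow> (\<exists>L. full_rank_lattice L \<and> (\<forall>v\<in>L. (+) v ` C = C))"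

definition active_neighbours :: "(real^4) set \<Rightarrow> real^4 \<Rightarrow> (real^4) set" where
  "active_neighbours C c = {y \<in> C - {c}. norm (y - c) < 2 * sqrt 2}"

definition direction :: "real^4 \<Rightarrow> real^4 \<Rightarrow> real^4" where
  "direction c y = (y - c) /\<^sub>R norm (y - c)"

text \<open>The index type \<^typ>\<open>4\<close> has the elements 0, 1, 2, 3, with 4 = 0; its linear order
  is used here only to pick each unordered pair of coordinates once.\<close>

definition D4_roots :: "(real^4) set" where
  "D4_roots = {s *\<^sub>R axis i 1 + t *\<^sub>R axis j 1 | i j s t.
                 i < j \<and> s \<in> {1, -1} \<and> t \<in> {1, -1}}"

definition root_directions :: "(real^4) set" where
  "root_directions = {\<alpha> /\<^sub>R sqrt 2 | \<alpha>. \<alpha> \<in> D4_roots}"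

definition single_deviation_packing :: "(real^4) set \<Rightarrow> bool" where
  "single_deviation_packing C \<longleftrightarrow>
     unit_ball_packing C \<and>
     (\<forall>c\<in>C. \<exists>\<^sub>\<le>\<^sub>1 d. d \<in> direction c ` active_neighbours C c \<and> d \<notin> root_directions)"

definition D4_lattice :: "(real^4) set" where
  "D4_lattice = {\<chi> i. of_int (m $ i) | m :: int^4. even (\<Sum>i\<in>UNIV. m $ i)}"

text \<open>The upper limit is taken in the extended reals, where it always exists. In a packing every
  ball contains only finitely many centres, so \<^const>\<open>card\<close> is a genuine count there.\<close>

definition packing_density :: "(real^4) set \<Rightarrow> ereal" where
  "packing_density C =
     Limsup at_top (\<lambda>\<rho> :: real.
       ereal (measure lborel (cball (0 :: real^4) 1) * real (card {c \<in> C. norm c \<le> \<rho>})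
              / measure lborel (cball (0 :: real^4) \<rho>)))"

end

theory Submission imports Defs begin

text \<open>
  Let \<open>K\<close> be the 24-cell of inradius 1 whose facets are orthogonal to the root directions; it has volume 8
  and circumradius \<open>sqrt 2\<close>. A neighbour in a root direction does not cut \<open>c + K\<close>, and neither does an
  inactive one, so the Voronoi cell of a centre \<open>c\<close> without deviating neighbour contains \<open>c + K\<close>.
  If \<open>c\<close> has a deviating neighbour \<open>y\<close>, then \<open>c\<close> is the deviating neighbour of \<open>y\<close>, and \<open>c + K\<close>,
  \<open>y + K\<close> may overlap. But then the neighbour of \<open>c\<close> in the root direction nearest to \<open>y - c\<close> is missing
  or far away, which frees a truncated pyramid \<open>B\<close> over the corresponding facet of \<open>c + K\<close>, and likewise
  one over the opposite facet of \<open>y + K\<close>. Cutting along this root direction, every slice of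
  \<open>(c + K) \<inter> (y + K)\<close> and of \<open>B \<inter> (y + K)\<close> is contained in an intersection of two octahedra whose radii
  have a constant sum; its volume is bounded by a constant \<open>X\<close>, and a polynomial inequality
  shows that the volume gained is at least the volume lost. Hence the Voronoi cells of \<open>c\<close> and \<open>y\<close> together
  contain a set of volume 16, symmetric about the midpoint of \<open>c\<close> and \<open>y\<close>, so each of them has
  volume at least 8, and the density is at most \<open>vol(B\<^sup>4) / 8\<close>.
\<close>

section \<open>A polynomial inequality\<close>

text \<open>A cell \<open>c + K\<close> has no slack: a deviating neighbour \<open>y\<close> at
  distance 2 lies off the facet normals, so its bisector cuts into \<open>c + K\<close>, and the
  loss must be paid for with space that the packing condition itself vacates. Let \<open>p\<close>
  be the component of \<open>y - c\<close> along the nearest root direction and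
  \<open>D\<^sup>2 = 4 - p\<^sup>2\<close>. If \<open>p < 2\<close>, the one number \<open>D\<close>
  controls both sides of the balance: the part of \<open>y - c\<close> orthogonal to the root has
  length at least \<open>D\<close>, which shrinks the slices of the overlap, and a third centre on
  the root ray lies at least \<open>D\<close> beyond the projection of \<open>y\<close>, which makes
  room for the pyramid. As \<open>p\<close> tends to 2, the volume of the pyramid and the bound for
  its part in \<open>y + K\<close> agree to first order in \<open>D\<close>. Octahedra with a common
  centre would therefore be too crude a bound for the slices; \<open>X\<close> has to use the
  orthogonal displacement. How this displacement is spread over the coordinates is unknown, hence
  two bounds for \<open>X\<close> and an alternative between one large coordinate and a large
  coordinate sum.\<close>

text \<open>Both polynomials have positive coefficients in the Bernstein basis of their interval.\<close>

lemma slice_polynomial_nonneg_coordinate: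
  fixes t :: real
  assumes "0 \<le> t" "t \<le> 5/12"
  shows "0 \<le> 9896/3825 - 243410512/26335125 * t + 291840672584/20146370625 * t^2 - 235390520096/20146370625 * t^3 - 7581033016/395026875 * t^4 + 2249516656/69710625 * t^5 - 159956552/4100625 * t^6"
proof -
  define u where "u = 5/12 - t"
  have t: "t = 5/12 - u" and u: "0 \<le> u" using assms by (auto simp: u_def)
  have "9896/3825 - 243410512/26335125 * t + 291840672584/20146370625 * t^2 - 235390520096/20146370625 * t^3 - 7581033016/395026875 * t^4 + 2249516656/69710625 * t^5 - 159956552/4100625 * t^6 = 3283255296/6640625 * (t^0 * u^6) + 755423756288/338671875 * (t^1 * u^5) + 655542884501504/155450390625 * (t^2 * u^4) + 2000467916945408/466351171875 * (t^3 * u^3) + 1093668384303232/466351171875 * (t^4 * u^2) + 487640389359808/839432109375 * (t^5 * u^1) + 68477243511416/12591481640625 * (t^6 * u^0)"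
    unfolding u_def by algebra
  moreover have "0 \<le> \<dots>" using assms(1) u by (intro add_nonneg_nonneg mult_nonneg_nonneg zero_le_power) auto
  ultimately show ?thesis by simp
qed

lemma slice_polynomial_nonneg_sum:
  fixes t :: real
  assumes "0 \<le> t" "t \<le> 1/3"
  shows "0 \<le> 3176/3825 - 71091112/26335125 * t + 3791492152/1185080625 * t^2 - 4153459888/1185080625 * t^3 - 5447979016/395026875 * t^4 + 1285049656/69710625 * t^5 - 159956552/4100625 * t^6"
proof -
  define u where "u = 1/3 - t"
  have t: "t = 1/3 - u" and u: "0 \<le> u" using assms by (auto simp: u_def)
  have "3176/3825 - 71091112/26335125 * t + 3791492152/1185080625 * t^2 - 4153459888/1185080625 * t^3 - 5447979016/395026875 * t^4 + 1285049656/69710625 * t^5 - 159956552/4100625 * t^6 = 257256/425 * (t^0 * u^6) + 322510568/108375 * (t^1 * u^5) + 88645558552/14630625 * (t^2 * u^4) + 284787710336/43891875 * (t^3 * u^3) + 160941197456/43891875 * (t^4 * u^2) + 360162564704/395026875 * (t^5 * u^1) + 7139854912/1185080625 * (t^6 * u^0)"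
    unfolding u_def by algebra
  moreover have "0 \<le> \<dots>" using assms(1) u by (intro add_nonneg_nonneg mult_nonneg_nonneg zero_le_power) auto
  ultimately show ?thesis by simp
qed


text \<open>Here \<open>X\<close> bounds the slices, \<open>T\<close> is the height of the free pyramid, \<open>p\<close> and \<open>D\<close> are the cosine and
  sine parts of the least allowed displacement, which has length 2. The tangent \<open>t\<close> of the half angle makes all of them rational.
  The thresholds come from \<open>8\<^sup>2 + 15\<^sup>2 = 17\<^sup>2\<close>.\<close>

lemma slice_polynomial_bound:
  fixes p a e r D T X z :: real
  assumes p: "0 \<le> p" "2 \<le> p\<^sup>2" "p < 2" and D: "0 \<le> D" "D\<^sup>2 = 4 - p\<^sup>2"
    and T: "T = 4/15 * (D - (2 - p))" and r: "r = 2 - p / 2" and z: "z = r - (a + e) / 2"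
    and a: "0 \<le> a" "a + e \<le> p" "0 \<le> e"
    and cases: "15/17 * D \<le> a \<or> 23/17 * D \<le> a + e"
    and X1: "X \<le> 4/3 * (r - a / 2) ^ 3" and X2: "X \<le> 2/3 * r * z * (r + z)"
  shows "(T + (2 - p) / 2) * X \<le> (1 - (1 - T) ^ 4) / 3 - 4/27 * T ^ 3 + 10/81 * T ^ 4"
proof -
  define t where "t = D / (2 + p)"
  define w where "w = 1 + t\<^sup>2"
  have w0: "w > 0" unfolding w_def by (simp add: add_pos_nonneg)
  have t0: "0 \<le> t" using p D by (simp add: t_def)
  have t2: "t\<^sup>2 * (2 + p) = 2 - p"
  proof -
    have "t\<^sup>2 * (2 + p)\<^sup>2 = (2 - p) * (2 + p)"
      using p D by (simp add: t_def power_divide) (simp add: power2_eq_square algebra_simps)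
    then show ?thesis using p by (simp add: power2_eq_square)
  qed
  have wp: "w * (2 + p) = 4" using t2 by (simp add: w_def algebra_simps)
  then have pw: "p = 4 / w - 2" using w0 by (simp add: field_simps)
  have Dw: "D = 4 * t / w" using wp w0 p by (simp add: t_def field_simps)
  have dw: "2 - p = 4 * t\<^sup>2 / w" using w0 by (simp add: pw field_simps w_def)
  have rw: "r = (1 + 3 * t\<^sup>2) / w" using w0 by (simp add: r pw field_simps w_def)
  have Tw: "T = 16/15 * t * (1 - t) / w" using w0 by (simp add: T Dw dw field_simps power2_eq_square)
  have th: "T + (2 - p) / 2 = t * (16 + 14 * t) / 15 / w" using w0
    by (simp add: Tw dw field_simps power2_eq_square)
  have th0: "0 \<le> T + (2 - p) / 2" unfolding th using t0 w0 by simp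
  \<comment> \<open>\<open>w ^ 4\<close> is the common denominator of both sides, so what remains is
    a comparison of polynomials in \<open>t\<close>.\<close>
  have lhs_w: "(1 - (1 - T) ^ 4) / 3 - 4/27 * T ^ 3 + 10/81 * T ^ 4 =
     ((w ^ 4 - (w - 16/15 * t * (1 - t)) ^ 4) / 3 - 4/27 * (16/15 * t * (1 - t)) ^ 3 * w
       + 10/81 * (16/15 * t * (1 - t)) ^ 4) / w ^ 4"
  proof -
    define T' where "T' = 16/15 * t * (1 - t)"
    have "1 - T = (w - T') / w" "T = T' / w" using w0 by (simp_all add: Tw T'_def field_simps)
    then have "(1 - (1 - T) ^ 4) / 3 - 4/27 * T ^ 3 + 10/81 * T ^ 4 =
        (1 - (w - T') ^ 4 / w ^ 4) / 3 - 4/27 * (T' ^ 3 / w ^ 3) + 10/81 * (T' ^ 4 / w ^ 4)"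
      by (simp add: power_divide)
    also have "\<dots> = ((w ^ 4 - (w - T') ^ 4) / 3 - 4/27 * T' ^ 3 * w + 10/81 * T' ^ 4) / w ^ 4"
      using w0 by (simp add: divide_simps) algebra
    finally show ?thesis by (simp add: T'_def)
  qed
  from cases show ?thesis
  proof
    assume A: "15/17 * D \<le> a"
    have "t\<^sup>2 * (2 + p) \<le> (5/12)\<^sup>2 * (2 + p)"
    proof -
      have "(141/100)\<^sup>2 \<le> p\<^sup>2" using p(2) by (simp add: power2_eq_square)
      then have "141/100 \<le> p" using p(1) by (rule power2_le_imp_le)
      then show ?thesis unfolding t2 by (simp add: power2_eq_square)
    qed
    then have "t\<^sup>2 \<le> (5/12)\<^sup>2" using p by simp
    \<comment> \<open>Since \<open>p\<close> is at least \<open>sqrt 2\<close>, the half angle is at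
      most 22.5 degrees; 5/12 lies just above its tangent \<open>sqrt 2 - 1\<close>.\<close>
    then have t1: "t \<le> 5/12" by (rule power2_le_imp_le) simp
    have ra: "0 \<le> r - a / 2" using a p r by simp
    have "X \<le> 4/3 * (r - 15/34 * D) ^ 3"
    proof -
      have "(r - a / 2) ^ 3 \<le> (r - 15/34 * D) ^ 3" using A ra by (intro power_mono) auto
      then show ?thesis using X1 by linarith
    qed
    then have "(T + (2 - p) / 2) * X \<le> (T + (2 - p) / 2) * (4/3 * (r - 15/34 * D) ^ 3)"
      using th0 by (rule mult_left_mono)
    also have "\<dots> = t * (16 + 14 * t) / 15 * (4/3 * ((1 + 3 * t\<^sup>2) - 30/17 * t) ^ 3) / w ^ 4"
    proof -
      have "r - 15/34 * D = ((1 + 3 * t\<^sup>2) - 30/17 * t) / w" by (simp add: rw Dw diff_divide_distrib)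
      then show ?thesis unfolding th using w0
        by (simp add: power_divide power_eq_if[of _ 4] power3_eq_cube)
    qed
    also have "\<dots> \<le> (1 - (1 - T) ^ 4) / 3 - 4/27 * T ^ 3 + 10/81 * T ^ 4"
      unfolding lhs_w
    proof (rule divide_right_mono)
      \<comment> \<open>The terms of degree 0 and 1 in \<open>t\<close> cancel between gain and
        loss, which leaves the factor \<open>t\<^sup>2\<close>.\<close>
      have "0 \<le> t\<^sup>2 * (9896/3825 - 243410512/26335125 * t + 291840672584/20146370625 * t^2 - 235390520096/20146370625 * t^3 - 7581033016/395026875 * t^4 + 2249516656/69710625 * t^5 - 159956552/4100625 * t^6)"
        by (rule mult_nonneg_nonneg) (use slice_polynomial_nonneg_coordinate[OF t0 t1] in simp_all)
      also have "\<dots> = ((w ^ 4 - (w - 16/15 * t * (1 - t)) ^ 4) / 3 - 4/27 * (16/15 * t * (1 - t)) ^ 3 * w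
          + 10/81 * (16/15 * t * (1 - t)) ^ 4)
          - t * (16 + 14 * t) / 15 * (4/3 * ((1 + 3 * t\<^sup>2) - 30/17 * t) ^ 3)"
        unfolding w_def by algebra
      finally show "t * (16 + 14 * t) / 15 * (4/3 * ((1 + 3 * t\<^sup>2) - 30/17 * t) ^ 3) \<le>
          (w ^ 4 - (w - 16/15 * t * (1 - t)) ^ 4) / 3 - 4/27 * (16/15 * t * (1 - t)) ^ 3 * w
          + 10/81 * (16/15 * t * (1 - t)) ^ 4"
        by (simp only: diff_ge_0_iff_ge)
    qed (use w0 in simp)
    finally show ?thesis .
  next
    assume B: "23/17 * D \<le> a + e"
    \<comment> \<open>This alternative forces \<open>23/17 * D \<le> p\<close>, hence a smaller
      angle than in the other case. The second polynomial is needed only on this shorter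
      interval.\<close>
    have t1: "t \<le> 1/3"
    proof (rule ccontr)
      assume "\<not> t \<le> 1/3"
      then have t: "t > 1/3" by simp
      have "23/17 * D \<le> p" using B a by simp
      then have "23/17 * (4 * t) \<le> 2 * (1 - t\<^sup>2)"
      proof -
        have "D * w = 4 * t" "p * w = 2 * (1 - t\<^sup>2)"
          using w0 by (simp_all add: Dw pw field_simps) (simp add: w_def algebra_simps)
        then show ?thesis using mult_right_mono[OF \<open>23/17 * D \<le> p\<close>, of w] w0
          by (simp add: mult.assoc)
      qed
      moreover have "t\<^sup>2 > 1/9" using mult_strict_mono[OF t t] t by (simp add: power2_eq_square)
      ultimately show False using t by simp
    qed
    have zz: "0 \<le> z" using a p r z by simp
    have zD: "z \<le> r - 23/34 * D" using B z by simp
    have r0: "0 \<le> r" using p r by simp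
    have "X \<le> 2/3 * r * (r - 23/34 * D) * (r + (r - 23/34 * D))"
      by (rule order_trans[OF X2]) (use zz zD r0 in \<open>intro mult_mono; auto\<close>)
    then have "(T + (2 - p) / 2) * X \<le> (T + (2 - p) / 2) * (2/3 * r * (r - 23/34 * D) * (r + (r - 23/34 * D)))"
      using th0 by (rule mult_left_mono)
    also have "\<dots> = t * (16 + 14 * t) / 15 * (2/3 * (1 + 3 * t\<^sup>2) * (1 + 3 * t\<^sup>2 - 46/17 * t) *
        (1 + 3 * t\<^sup>2 + (1 + 3 * t\<^sup>2 - 46/17 * t))) / w ^ 4"
    proof -
      have "r - 23/34 * D = (1 + 3 * t\<^sup>2 - 46/17 * t) / w" by (simp add: rw Dw diff_divide_distrib)
      then show ?thesis unfolding th rw using w0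
        by (simp add: power_eq_if[of _ 4] power3_eq_cube add_divide_distrib[symmetric])
    qed
    also have "\<dots> \<le> (1 - (1 - T) ^ 4) / 3 - 4/27 * T ^ 3 + 10/81 * T ^ 4"
      unfolding lhs_w
    proof (rule divide_right_mono)
      have "0 \<le> t\<^sup>2 * (3176/3825 - 71091112/26335125 * t + 3791492152/1185080625 * t^2 - 4153459888/1185080625 * t^3 - 5447979016/395026875 * t^4 + 1285049656/69710625 * t^5 - 159956552/4100625 * t^6)"
        by (rule mult_nonneg_nonneg) (use slice_polynomial_nonneg_sum[OF t0 t1] in simp_all)
      also have "\<dots> = ((w ^ 4 - (w - 16/15 * t * (1 - t)) ^ 4) / 3 - 4/27 * (16/15 * t * (1 - t)) ^ 3 * w
          + 10/81 * (16/15 * t * (1 - t)) ^ 4)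
          - t * (16 + 14 * t) / 15 * (2/3 * (1 + 3 * t\<^sup>2) * (1 + 3 * t\<^sup>2 - 46/17 * t) *
        (1 + 3 * t\<^sup>2 + (1 + 3 * t\<^sup>2 - 46/17 * t)))"
        unfolding w_def by algebra
      finally show "t * (16 + 14 * t) / 15 * (2/3 * (1 + 3 * t\<^sup>2) * (1 + 3 * t\<^sup>2 - 46/17 * t) *
        (1 + 3 * t\<^sup>2 + (1 + 3 * t\<^sup>2 - 46/17 * t))) \<le>
          (w ^ 4 - (w - 16/15 * t * (1 - t)) ^ 4) / 3 - 4/27 * (16/15 * t * (1 - t)) ^ 3 * w
          + 10/81 * (16/15 * t * (1 - t)) ^ 4"
        by (simp only: diff_ge_0_iff_ge)
    qed (use w0 in simp)
    finally show ?thesis .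
  qed
qed

section \<open>Intersections of two octahedra\<close>

definition tent :: "real \<Rightarrow> real \<Rightarrow> real \<Rightarrow> real" where
  "tent m c u = max 0 (m - \<bar>u - c\<bar>)"

lemma tent_measurable [measurable]: "tent m c \<in> borel_measurable borel"
  unfolding tent_def[abs_def] by measurable

lemma tent_power_integral:
  assumes m: "0 \<le> m" and n: "0 < n"
  shows "has_bochner_integral lborel (\<lambda>u. tent m c u ^ n) (2 * m ^ Suc n / real (Suc n))"
proof -
  have *: "has_bochner_integral lborel (\<lambda>u. indicator {0..m} u *\<^sub>R (m - u) ^ n) (m ^ Suc n / real (Suc n))"
  proof -
    have "has_bochner_integral lborel (\<lambda>u. indicator {0..m} u *\<^sub>R (m - u) ^ n)
       (- ((m - m) ^ Suc n) / real (Suc n) - (- ((m - 0) ^ Suc n) / real (Suc n)))"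
    proof (rule has_bochner_integral_FTC_Icc)
      show "((\<lambda>u. - ((m - u) ^ Suc n) / real (Suc n)) has_vector_derivative (m - x) ^ n) (at x within {0..m})"
        for x
      proof -
        have "((\<lambda>u. - ((m - u) ^ Suc n)) has_real_derivative real (Suc n) * (m - x) ^ n) (at x within {0..m})"
          by (rule derivative_eq_intros refl | simp)+
        from DERIV_cdivide[OF this, of "real (Suc n)"] show ?thesis
          unfolding has_real_derivative_iff_has_vector_derivative[symmetric]
          by (simp del: of_nat_Suc power_Suc)
      qed
      show "continuous_on {0..m} (\<lambda>x. (m - x) ^ n)" by (intro continuous_intros)
    qed (use m in auto)
    then show ?thesis by simp
  qed
  have l: "has_bochner_integral lborel (\<lambda>u. indicator {0..m} (- u + c) *\<^sub>R (m - (- u + c)) ^ n) (m ^ Suc n / real (Suc n))"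
    using lborel_has_bochner_integral_real_affine_iff[of "-1" "\<lambda>u. indicator {0..m} u *\<^sub>R (m - u) ^ n" _ c] *
    by (simp add: algebra_simps)
  have r: "has_bochner_integral lborel (\<lambda>u. indicator {0..m} (u - c) *\<^sub>R (m - (u - c)) ^ n) (m ^ Suc n / real (Suc n))"
    using lborel_has_bochner_integral_real_affine_iff[of "1" "\<lambda>u. indicator {0..m} u *\<^sub>R (m - u) ^ n" _ "-c"] *
    by (simp add: algebra_simps)
  have "has_bochner_integral lborel (\<lambda>u. indicator {0..m} (- u + c) *\<^sub>R (m - (- u + c)) ^ n
       + indicator {0..m} (u - c) *\<^sub>R (m - (u - c)) ^ n)  (m ^ Suc n / real (Suc n) + m ^ Suc n / real (Suc n))"
    by (intro has_bochner_integral_add l r)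
  \<comment> \<open>At the peak \<open>c\<close> both halves are counted, so the identity holds only
    almost everywhere.\<close>
  moreover have "AE u in lborel. indicator {0..m} (- u + c) *\<^sub>R (m - (- u + c)) ^ n
       + indicator {0..m} (u - c) *\<^sub>R (m - (u - c)) ^ n = tent m c u ^ n"
    using AE_lborel_singleton[of c]
  proof eventually_elim
    case (elim u)
    then show ?case using n by (auto simp: tent_def indicator_def abs_if max_def)
  qed
  ultimately have "has_bochner_integral lborel (\<lambda>u. tent m c u ^ n)
      (m ^ Suc n / real (Suc n) + m ^ Suc n / real (Suc n))"
    by (subst (asm) has_bochner_integral_cong_AE) auto
  then show ?thesis by (simp del: of_nat_Suc power_Suc)
qed

lemma tent_integral: "0 \<le> m \<Longrightarrow> has_bochner_integral lborel (tent m c) (m\<^sup>2)"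
  using tent_power_integral[of m 1 c] by (simp add: power2_eq_square)

lemma tent_square_integral:
  "0 \<le> m \<Longrightarrow> has_bochner_integral lborel (\<lambda>u. (tent m c u)\<^sup>2) (2 / 3 * m ^ 3)"
  using tent_power_integral[of m 2 c] by (simp add: power2_eq_square power3_eq_cube)

text \<open>Writing the second factor as a difference of tents keeps the bound independent of the
  relative position of the two centres.\<close>

lemma tent_product_le:
  assumes m: "0 \<le> m" and z: "0 \<le> z" and R: "m + z \<le> R"
  shows "tent R c u * min z (tent (m + z) c' u) \<le>
    (R - (m + z)) * (tent (m + z) c' u - tent m c' u)
    + ((tent (m + z) c u)\<^sup>2 - (tent m c u)\<^sup>2 - 2 * z * tent m c u
       + (tent (m + z) c' u)\<^sup>2 - (tent m c' u)\<^sup>2 - 2 * z * tent m c' u) / 2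
    + z * tent m c u"
proof -
  \<comment> \<open>The capped tent \<open>min z (tent (m + z) c' u)\<close> is the difference of
    two tents with the same centre and slopes.\<close>
  define g where "g = tent (m + z) c' u - tent m c' u"
  define h1 where "h1 = tent (m + z) c u - tent m c u"
  define h2 where "h2 = tent m c u"
  have g: "g = min z (tent (m + z) c' u)" "0 \<le> g" "g \<le> z"
    using m z by (auto simp: g_def tent_def max_def min_def)
  have f: "tent R c u \<le> R - (m + z) + (h1 + h2)"
    using m z R by (auto simp: h1_def h2_def tent_def)
  have h2: "0 \<le> h2" by (simp add: h2_def tent_def)
  \<comment> \<open>Where the smaller tent is positive, the difference is the constant
    \<open>z\<close>. This turns its square into a combination of single tents and squares of tents,
    whose integrals do not depend on the centre.\<close>
  have sq: "(tent (m + z) b u)\<^sup>2 - (tent m b u)\<^sup>2 - 2 * z * tent m b u = (tent (m + z) b u - tent m b u)\<^sup>2"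
    for b
  proof (cases "tent m b u = 0")
    case False
    then have "tent (m + z) b u = tent m b u + z" using m z by (auto simp: tent_def max_def split: if_splits)
    then show ?thesis by (simp add: power2_eq_square algebra_simps)
  qed simp
  have "tent R c u * g \<le> (R - (m + z) + (h1 + h2)) * g"
    using f g by (intro mult_right_mono) auto
  also have "\<dots> = (R - (m + z)) * g + h1 * g + h2 * g" by (simp add: algebra_simps)
  also have "\<dots> \<le> (R - (m + z)) * g + (h1\<^sup>2 + g\<^sup>2) / 2 + z * h2"
  proof -
    have "h1 * g \<le> (h1\<^sup>2 + g\<^sup>2) / 2" using sum_squares_bound[of h1 g] by simp
    moreover have "h2 * g \<le> z * h2" using mult_left_mono[OF g(3) h2] by (simp add: mult.commute)
    ultimately show ?thesis by linarith
  qed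
  also have "h1\<^sup>2 = (tent (m + z) c u)\<^sup>2 - (tent m c u)\<^sup>2 - 2 * z * tent m c u"
    by (simp add: h1_def sq)
  also have "g\<^sup>2 = (tent (m + z) c' u)\<^sup>2 - (tent m c' u)\<^sup>2 - 2 * z * tent m c' u"
    by (simp add: g_def sq)
  finally show ?thesis unfolding g(1)[symmetric] by (simp add: g_def h2_def add_diff_eq)
qed

lemma nn_integral_has_bochner_integral:
  assumes "has_bochner_integral M f x" "\<And>u. 0 \<le> f u"
  shows "(\<integral>\<^sup>+u. ennreal (f u) \<partial>M) = ennreal x"
  using assms by (subst nn_integral_eq_integral) (auto simp: has_bochner_integral_iff)

lemma nn_integral_tent_square_le:
  assumes "0 \<le> m" and f: "\<And>u. f u \<le> 2 * (tent m c u)\<^sup>2"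
  shows "(\<integral>\<^sup>+u. ennreal (f u) \<partial>lborel) \<le> ennreal (4/3 * m ^ 3)"
proof -
  have "(\<integral>\<^sup>+u. ennreal (f u) \<partial>lborel) \<le> (\<integral>\<^sup>+u. ennreal (2 * (tent m c u)\<^sup>2) \<partial>lborel)"
    by (intro nn_integral_mono ennreal_leI f)
  also have "\<dots> = ennreal (2 * (2/3 * m ^ 3))"
    by (intro nn_integral_has_bochner_integral has_bochner_integral_mult_right tent_square_integral)
       (use assms in auto)
  finally show ?thesis by simp
qed

lemma nn_integral_tent_product_le:
  assumes m: "0 \<le> m" and z: "0 \<le> z" and R: "m + z \<le> R"
    and f: "\<And>u. f u \<le> 2 * (tent R c u * min z (tent (m + z) c' u))"
  shows "(\<integral>\<^sup>+u. ennreal (f u) \<partial>lborel) \<le>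
    ennreal (2 * ((R - (m + z)) * (z\<^sup>2 + 2 * z * m) + 2 * z\<^sup>2 * m + 2/3 * z ^ 3 + z * m\<^sup>2))"
proof -
  let ?g = "\<lambda>u. 2 * ((R - (m + z)) * (tent (m + z) c' u - tent m c' u)
    + ((tent (m + z) c u)\<^sup>2 - (tent m c u)\<^sup>2 - 2 * z * tent m c u
       + (tent (m + z) c' u)\<^sup>2 - (tent m c' u)\<^sup>2 - 2 * z * tent m c' u) / 2
    + z * tent m c u)"
  have mz: "0 \<le> m + z" using m z by simp
  have le: "2 * (tent R c u * min z (tent (m + z) c' u)) \<le> ?g u" for u
    using mult_left_mono[OF tent_product_le[OF m z R, of c u c'], of 2] by simp
  have nonneg: "0 \<le> ?g u" for u
    by (rule order_trans[OF _ le]) (use z in \<open>simp add: tent_def\<close>)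
  have "(\<integral>\<^sup>+u. ennreal (f u) \<partial>lborel) \<le> (\<integral>\<^sup>+u. ennreal (?g u) \<partial>lborel)"
    by (intro nn_integral_mono ennreal_leI order_trans[OF f le])
  also have "\<dots> = ennreal (2 * ((R - (m + z)) * ((m + z)\<^sup>2 - m\<^sup>2)
    + (2/3 * (m + z) ^ 3 - 2/3 * m ^ 3 - 2 * z * m\<^sup>2
       + 2/3 * (m + z) ^ 3 - 2/3 * m ^ 3 - 2 * z * m\<^sup>2) / 2 + z * m\<^sup>2))"
    by (intro nn_integral_has_bochner_integral has_bochner_integral_mult_right
        has_bochner_integral_add has_bochner_integral_diff has_bochner_integral_divide_zero
        tent_integral tent_square_integral)
       (use m mz nonneg in auto)
  also have "2 * ((R - (m + z)) * ((m + z)\<^sup>2 - m\<^sup>2)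
    + (2/3 * (m + z) ^ 3 - 2/3 * m ^ 3 - 2 * z * m\<^sup>2
       + 2/3 * (m + z) ^ 3 - 2/3 * m ^ 3 - 2 * z * m\<^sup>2) / 2 + z * m\<^sup>2)
    = 2 * ((R - (m + z)) * (z\<^sup>2 + 2 * z * m) + 2 * z\<^sup>2 * m + 2/3 * z ^ 3 + z * m\<^sup>2)"
    by algebra
  finally show ?thesis .
qed


section \<open>Overlap volumes from planar slices\<close>

lemma emeasure_lborel_prod_eq:
  fixes A :: "('a::euclidean_space \<times> 'b::euclidean_space) set"
  assumes "A \<in> sets borel"
  shows "emeasure lborel A = (\<integral>\<^sup>+u. emeasure lborel (Pair u -` A) \<partial>lborel)"
proof -
  have "emeasure lborel A = emeasure (lborel \<Otimes>\<^sub>M lborel) A" by (simp add: lborel_prod)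
  also have "\<dots> = (\<integral>\<^sup>+u. emeasure lborel (Pair u -` A) \<partial>lborel)"
    by (rule lborel.emeasure_pair_measure_alt) (subst lborel_prod, use assms in simp)
  finally show ?thesis .
qed

lemma emeasure_lborel_Times:
  fixes A :: "'a::euclidean_space set" and B :: "'b::euclidean_space set"
  assumes "A \<in> sets borel" "B \<in> sets borel"
  shows "emeasure lborel (A \<times> B) = emeasure lborel A * emeasure lborel B"
  using lborel.emeasure_pair_measure_Times[of A lborel B] assms by (simp add: lborel_prod)

text \<open>In the last two coordinates the \<open>l\<^sub>1\<close> balls of radii \<open>r1\<close> and \<open>r2\<close> are rotated by 45 degrees.\<close>

definition diamond_overlap :: "real \<Rightarrow> real \<Rightarrow> real \<Rightarrow> real \<Rightarrow> real \<Rightarrow> (real \<times> real \<times> real) set" where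
  "diamond_overlap r1 r2 a b c = {q. \<bar>fst q\<bar> + sqrt 2 * \<bar>fst (snd q)\<bar> < r1 \<and> \<bar>fst q\<bar> + sqrt 2 * \<bar>snd (snd q)\<bar> < r1 \<and>
     \<bar>fst q - a\<bar> + sqrt 2 * \<bar>fst (snd q) - b\<bar> < r2 \<and> \<bar>fst q - a\<bar> + sqrt 2 * \<bar>snd (snd q) - c\<bar> < r2}"

lemma open_diamond_overlap: "open (diamond_overlap r1 r2 a b c)"
  unfolding diamond_overlap_def by (intro open_Collect_conj open_Collect_less continuous_intros)

text \<open>A slice at \<open>u\<close> is the intersection of two squares with half sides
  \<open>R1 / sqrt 2\<close> and \<open>R2 / sqrt 2\<close>. One side of this rectangle is at most
  that of the smaller square, which the tent bounds; the other also feels the displacement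
  \<open>b\<close> of the centres, which \<open>g\<close> bounds.\<close>

lemma emeasure_diamond_overlap_le:
  fixes g :: "real \<Rightarrow> real"
  assumes g: "\<And>u. 0 \<le> g u"
    "\<And>u. min (min (r1 - \<bar>u\<bar>) (r2 - \<bar>u - a\<bar>)) ((r1 - \<bar>u\<bar> + (r2 - \<bar>u - a\<bar>) - sqrt 2 * b) / 2) \<le> g u"
  shows "emeasure lborel (diamond_overlap r1 r2 a b c) \<le>
    (\<integral>\<^sup>+u. ennreal (2 * (tent ((r1 + r2 - a) / 2) ((r1 - r2 + a) / 2) u * g u)) \<partial>lborel)"
proof -
  have "emeasure lborel (Pair u -` diamond_overlap r1 r2 a b c) \<le>
      ennreal (2 * (tent ((r1 + r2 - a) / 2) ((r1 - r2 + a) / 2) u * g u))" for u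
  proof -
    define R1 R2 where "R1 = r1 - \<bar>u\<bar>" and "R2 = r2 - \<bar>u - a\<bar>"
    define k where "k = min R1 R2"
    have kt: "k \<le> tent ((r1 + r2 - a) / 2) ((r1 - r2 + a) / 2) u"
      unfolding k_def R1_def R2_def tent_def by (auto simp: min_def max_def abs_if field_simps)
    define lx hx where "lx = max (- R1 / sqrt 2) (b - R2 / sqrt 2)" and "hx = min (R1 / sqrt 2) (b + R2 / sqrt 2)"
    \<comment> \<open>The centre, in the last coordinate, of the smaller of the two squares.\<close>
    define ly where "ly = (if R1 \<le> R2 then 0 else c)"
    have abs_less: "\<bar>x\<bar> < R / sqrt 2 \<longleftrightarrow> sqrt 2 * \<bar>x\<bar> < R" for x R :: real by (simp add: field_simps)
    have sub: "Pair u -` diamond_overlap r1 r2 a b c \<subseteq> {lx<..<hx} \<times> {ly - k / sqrt 2<..<ly + k / sqrt 2}"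
    proof
      fix q assume "q \<in> Pair u -` diamond_overlap r1 r2 a b c"
      moreover obtain x y where q: "q = (x, y)" by (cases q)
      ultimately have "\<bar>x\<bar> < R1 / sqrt 2" "\<bar>y\<bar> < R1 / sqrt 2" "\<bar>x - b\<bar> < R2 / sqrt 2" "\<bar>y - c\<bar> < R2 / sqrt 2"
        unfolding abs_less by (auto simp: diamond_overlap_def R1_def R2_def)
      then show "q \<in> {lx<..<hx} \<times> {ly - k / sqrt 2<..<ly + k / sqrt 2}"
        unfolding q by (auto simp: lx_def hx_def ly_def k_def min_def)
    qed
    show ?thesis
    proof (cases "lx < hx \<and> 0 < k")
      case False
      then have "{lx<..<hx} \<times> {ly - k / sqrt 2<..<ly + k / sqrt 2} = {}"
        using divide_nonpos_pos[of k "sqrt 2"] by (auto simp: not_less)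
      with sub have "Pair u -` diamond_overlap r1 r2 a b c = {}" by (metis subset_empty)
      then show ?thesis by simp
    next
      case True
      have "hx - lx = min (min (2 * R1) (2 * R2)) (min (R1 + R2 - sqrt 2 * b) (R1 + R2 + sqrt 2 * b)) / sqrt 2"
        unfolding lx_def hx_def by (auto simp: min_def max_def field_simps)
      also have "\<dots> = sqrt 2 * (min (min (2 * R1) (2 * R2)) (min (R1 + R2 - sqrt 2 * b) (R1 + R2 + sqrt 2 * b)) / 2)"
        by (simp add: field_simps)
      also have "\<dots> \<le> sqrt 2 * g u"
        using g(2)[of u] unfolding R1_def[symmetric] R2_def[symmetric] by (intro mult_left_mono) (auto simp: min_def split: if_splits)
      finally have hl: "hx - lx \<le> sqrt 2 * g u" .
      have "emeasure lborel (Pair u -` diamond_overlap r1 r2 a b c) \<le>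
          emeasure lborel ({lx<..<hx} \<times> {ly - k / sqrt 2<..<ly + k / sqrt 2})"
        by (rule emeasure_mono[OF sub]) (simp add: borel_Times)
      also have "\<dots> = ennreal (hx - lx) * ennreal (2 * k / sqrt 2)"
        using True by (subst emeasure_lborel_Times) (auto simp: field_simps)
      also have "2 * k / sqrt 2 = sqrt 2 * k" by (simp add: field_simps)
      also have "ennreal (hx - lx) * ennreal (sqrt 2 * k) = ennreal ((hx - lx) * (sqrt 2 * k))"
        using True by (simp add: ennreal_mult)
      also have "\<dots> \<le> ennreal (2 * (tent ((r1 + r2 - a) / 2) ((r1 - r2 + a) / 2) u * g u))"
      proof (rule ennreal_leI)
        have "(hx - lx) * (sqrt 2 * k) \<le> (sqrt 2 * g u) * (sqrt 2 * tent ((r1 + r2 - a) / 2) ((r1 - r2 + a) / 2) u)"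
          using hl True kt g(1)[of u] by (intro mult_mono) auto
        also have "\<dots> = (sqrt 2 * sqrt 2) * (tent ((r1 + r2 - a) / 2) ((r1 - r2 + a) / 2) u * g u)"
          by (simp only: mult_ac)
        finally show "(hx - lx) * (sqrt 2 * k) \<le> 2 * (tent ((r1 + r2 - a) / 2) ((r1 - r2 + a) / 2) u * g u)"
          by simp
      qed
      finally show ?thesis .
    qed
  qed
  then show ?thesis
    by (subst emeasure_lborel_prod_eq) (auto intro: nn_integral_mono borel_open open_diamond_overlap)
qed

text \<open>Here \<open>r\<close> is the mean radius and \<open>2 * z\<close> the sum of the radii
  minus the displacement \<open>a + sqrt 2 * b\<close>. The first bound is the volume of an
  octahedron of radius \<open>r - a / 2\<close>: it sees only the displacement in one coordinate.
  The second vanishes at \<open>z = 0\<close>, where the two octahedra separate.\<close>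

lemma diamond_overlap_bounds:
  assumes a: "0 \<le> a" and b: "0 \<le> b" and r: "r = (r1 + r2) / 2" and z: "z = r - (a + sqrt 2 * b) / 2" "0 \<le> z"
  shows "emeasure lborel (diamond_overlap r1 r2 a b c) \<le> ennreal (4/3 * (r - a / 2) ^ 3)"
    and "emeasure lborel (diamond_overlap r1 r2 a b c) \<le> ennreal (2/3 * r * z * (r + z))"
proof -
  define e where "e = sqrt 2 * b"
  have e0: "0 \<le> e" using b by (simp add: e_def)
  define R c0 where "R = (r1 + r2 - a) / 2" and "c0 = (r1 - r2 + a) / 2"
  have Rr: "R = r - a / 2" using r by (simp add: R_def field_simps)
  have R: "R = z + e / 2" using z r by (simp add: R_def e_def field_simps)
  have R0: "0 \<le> R" using R z e0 by simp
  note le = emeasure_diamond_overlap_le[where ?r1.0=r1 and ?r2.0=r2 and a=a and b=b and c=c, folded R_def c0_def e_def]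
  have t: "min (r1 - \<bar>u\<bar>) (r2 - \<bar>u - a\<bar>) \<le> R - \<bar>u - c0\<bar>" for u
    unfolding R_def c0_def by (auto simp: min_def abs_if field_simps)
  have g1: "min (min (r1 - \<bar>u\<bar>) (r2 - \<bar>u - a\<bar>)) x \<le> tent R c0 u" for u x
    by (rule order_trans[OF min.cobounded1]) (use t[of u] in \<open>simp add: tent_def\<close>)
  have "emeasure lborel (diamond_overlap r1 r2 a b c) \<le> (\<integral>\<^sup>+u. ennreal (2 * (tent R c0 u * tent R c0 u)) \<partial>lborel)"
    by (rule le) (rule g1 | simp add: tent_def)+
  also have "\<dots> \<le> ennreal (4/3 * R ^ 3)"
    by (rule nn_integral_tent_square_le[where c=c0]) (use R0 in \<open>auto simp: power2_eq_square\<close>)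
  finally show "emeasure lborel (diamond_overlap r1 r2 a b c) \<le> ennreal (4/3 * (r - a / 2) ^ 3)"
    by (simp add: Rr)
  \<comment> \<open>The half sum is at most \<open>z\<close> because
    \<open>\<bar>u\<bar> + \<bar>u - a\<bar>\<close> is at least \<open>a\<close>, and at most a
    tent about \<open>a / 2\<close> because it is at least \<open>2 * \<bar>u - a / 2\<bar>\<close>.
    Of this tent and the one about \<open>c0\<close>, the lower is taken; its height is
    \<open>m + z\<close> in either case.\<close>
  define m where "m = min a e / 2"
  define c' where "c' = (if e \<le> a then c0 else a / 2)"
  have m0: "0 \<le> m" using a e0 by (simp add: m_def)
  have mz: "m + z \<le> R" by (simp add: m_def R)
  have g: "min (min (r1 - \<bar>u\<bar>) (r2 - \<bar>u - a\<bar>)) ((r1 - \<bar>u\<bar> + (r2 - \<bar>u - a\<bar>) - e) / 2) \<le> min z (tent (m + z) c' u)" for u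
  proof -
    have 1: "(r1 - \<bar>u\<bar> + (r2 - \<bar>u - a\<bar>) - e) / 2 \<le> z"
      using z r by (simp add: e_def abs_if field_simps)
    have 2: "(r1 - \<bar>u\<bar> + (r2 - \<bar>u - a\<bar>) - e) / 2 \<le> r - e / 2 - \<bar>u - a / 2\<bar>"
      using r by (simp add: abs_if field_simps)
    show ?thesis
    proof (cases "e \<le> a")
      case True
      then have "m + z = R" by (simp add: m_def R)
      then show ?thesis using 1 t[of u] True by (auto simp: tent_def c'_def min_def max_def split: if_splits)
    next
      case False
      then have "m + z = r - e / 2" using z by (simp add: m_def e_def field_simps)
      then show ?thesis using 1 2 False by (auto simp: tent_def c'_def min_def max_def split: if_splits)
    qed
  qed
  have "emeasure lborel (diamond_overlap r1 r2 a b c) \<le> (\<integral>\<^sup>+u. ennreal (2 * (tent R c0 u * min z (tent (m + z) c' u))) \<partial>lborel)"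
    by (rule le) (use g z in \<open>auto simp: tent_def\<close>)
  also have "\<dots> \<le> ennreal (2 * ((R - (m + z)) * (z\<^sup>2 + 2 * z * m) + 2 * z\<^sup>2 * m + 2/3 * z ^ 3 + z * m\<^sup>2))"
    by (rule nn_integral_tent_product_le[OF m0 z(2) mz order_refl])
  also have "\<dots> \<le> ennreal (2/3 * r * z * (r + z))"
  proof (rule ennreal_leI)
    have rS: "r = z + (a + e) / 2" using z by (simp add: e_def)
    \<comment> \<open>For \<open>a \<le> e\<close> the difference is
      \<open>z * (e - 2 * a)\<^sup>2 / 6\<close>, so \<open>2/3 * r * z * (r + z)\<close> is reached
      by the integral bound at \<open>e = 2 * a\<close>.\<close>
    have "2/3 * r * z * (r + z) - 2 * ((R - (m + z)) * (z\<^sup>2 + 2 * z * m) + 2 * z\<^sup>2 * m + 2/3 * z ^ 3 + z * m\<^sup>2)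
       = z\<^sup>2 * (a - 2 * m) + z * ((a + e)\<^sup>2 / 6 - 2 * m * (e - m))"
      unfolding rS R by (simp add: field_simps power2_eq_square power3_eq_cube)
    moreover have "0 \<le> z\<^sup>2 * (a - 2 * m)" by (simp add: m_def)
    moreover have "2 * m * (e - m) \<le> (a + e)\<^sup>2 / 6"
    proof (cases "e \<le> a")
      case True
      then have m: "m = e / 2" by (simp add: m_def)
      have "2 * e * (2 * e) \<le> (a + e) * (a + e)" using True e0 a by (intro mult_mono) auto
      then show ?thesis unfolding m power2_eq_square using e0 a True
        by (simp add: field_simps) (smt (verit) mult_nonneg_nonneg mult_mono)
    next
      case False
      then have m: "m = a / 2" by (simp add: m_def)
      have "0 \<le> (e - 2 * a)\<^sup>2" by simp
      then show ?thesis unfolding m power2_eq_square by (simp add: field_simps)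
    qed
    then have "0 \<le> z * ((a + e)\<^sup>2 / 6 - 2 * m * (e - m))" using z by simp
    ultimately show "2 * ((R - (m + z)) * (z\<^sup>2 + 2 * z * m) + 2 * z\<^sup>2 * m + 2/3 * z ^ 3 + z * m\<^sup>2) \<le> 2/3 * r * z * (r + z)"
      by linarith
  qed
  finally show "emeasure lborel (diamond_overlap r1 r2 a b c) \<le> ennreal (2/3 * r * z * (r + z))" .
qed

section \<open>Slices of four-dimensional sets\<close>

definition vec4 :: "real \<Rightarrow> real \<Rightarrow> real \<Rightarrow> real \<Rightarrow> real^4" where
  "vec4 a b c d = (\<chi> i. if i = 1 then a else if i = 2 then b else if i = 3 then c else d)"

lemma vec4_nth [simp]: "vec4 a b c d $ 1 = a" "vec4 a b c d $ 2 = b" "vec4 a b c d $ 3 = c" "vec4 a b c d $ 4 = d"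
  by (simp_all add: vec4_def)

lemma vec4_eq_iff: "(x::real^4) = y \<longleftrightarrow> x$1 = y$1 \<and> x$2 = y$2 \<and> x$3 = y$3 \<and> x$4 = y$4"
  by (simp add: vec_eq_iff forall_4)

lemma norm_vec4: "(norm (x::real^4))\<^sup>2 = (x$1)\<^sup>2 + (x$2)\<^sup>2 + (x$3)\<^sup>2 + (x$4)\<^sup>2"
  unfolding power2_norm_eq_inner inner_vec_def sum_4 by (simp add: power2_eq_square)

lemma distr_lborel_orthogonal:
  fixes T :: "real^4 \<Rightarrow> real^4"
  assumes T: "orthogonal_transformation T"
  shows "distr lborel borel T = lborel"
proof (rule lborel_eqI[symmetric])
  have [measurable]: "T \<in> borel_measurable borel"
    using orthogonal_transformation_linear[OF T]
    by (intro borel_measurable_continuous_onI linear_continuous_on) (simp add: linear_conv_bounded_linear)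
  fix l u :: "real^4" assume lu: "\<And>b. b \<in> Basis \<Longrightarrow> l \<bullet> b \<le> u \<bullet> b"
  have inv: "orthogonal_transformation (inv T)" using T by (rule orthogonal_transformation_inv)
  have eq: "T -` box l u = inv T ` box l u"
    using orthogonal_transformation_bij[OF T] by (simp add: bij_vimage_eq_inv_image)
  have "emeasure (distr lborel borel T) (box l u) = emeasure lborel (T -` box l u)"
    by (subst emeasure_distr) auto
  also have "\<dots> = emeasure lebesgue (inv T ` box l u)"
    unfolding eq[symmetric] using measurable_sets[of T borel borel "box l u"] by simp
  also have "\<dots> = emeasure lebesgue (box l u)"
  proof -
    have l: "box l u \<in> lmeasurable" by simp
    show ?thesis
      by (simp only: emeasure_eq_measure2[OF measurable_orthogonal_image[OF inv l]]
          emeasure_eq_measure2[OF l] measure_orthogonal_image[OF inv l])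
  qed
  also have "\<dots> = ennreal (\<Prod>b\<in>Basis. (u - l) \<bullet> b)" using lu by simp
  finally show "emeasure (distr lborel borel T) (box l u) = ennreal (\<Prod>b\<in>Basis. (u - l) \<bullet> b)" .
qed simp

lemma emeasure_orthogonal_vimage:
  fixes T :: "real^4 \<Rightarrow> real^4"
  assumes T: "orthogonal_transformation T" and A: "A \<in> sets borel"
  shows "T -` A \<in> sets borel" "emeasure lborel (T -` A) = emeasure lborel A"
proof -
  have [measurable]: "T \<in> borel_measurable borel"
    using orthogonal_transformation_linear[OF T]
    by (intro borel_measurable_continuous_onI linear_continuous_on) (simp add: linear_conv_bounded_linear)
  show "T -` A \<in> sets borel" using measurable_sets[of T borel borel A] A by simp
  show "emeasure lborel (T -` A) = emeasure lborel A"
    using A by (subst (2) distr_lborel_orthogonal[OF T, symmetric]) (simp add: emeasure_distr)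
qed

definition coords :: "real^4 \<Rightarrow> real \<times> real \<times> real \<times> real" where
  "coords x = (x$1, x$2, x$3, x$4)"

lemma coords_measurable [measurable]: "coords \<in> borel_measurable borel"
  unfolding coords_def[abs_def] by (intro borel_measurable_continuous_onI continuous_intros)

lemma distr_lborel_coords: "distr lborel borel coords = lborel"
proof (rule lborel_eqI[symmetric])
  fix l u :: "real \<times> real \<times> real \<times> real" assume lu: "\<And>b. b \<in> Basis \<Longrightarrow> l \<bullet> b \<le> u \<bullet> b"
  obtain l1 l2 l3 l4 u1 u2 u3 u4 where l: "l = (l1, l2, l3, l4)" and u: "u = (u1, u2, u3, u4)"
    by (metis surj_pair)
  have le: "l1 \<le> u1" "l2 \<le> u2" "l3 \<le> u3" "l4 \<le> u4"
    using lu[of "(1, 0, 0, 0)"] lu[of "(0, 1, 0, 0)"] lu[of "(0, 0, 1, 0)"] lu[of "(0, 0, 0, 1)"]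
    by (auto simp: l u Basis_prod_def zero_prod_def)
  have eq: "coords -` box l u = box (vec4 l1 l2 l3 l4) (vec4 u1 u2 u3 u4)"
    by (auto simp: coords_def l u box_prod mem_box_cart forall_4)
  have "emeasure (distr lborel borel coords) (box l u) = emeasure lborel (coords -` box l u)"
    by (simp add: emeasure_distr)
  also have "\<dots> = ennreal (\<Prod>b\<in>Basis. (vec4 u1 u2 u3 u4 - vec4 l1 l2 l3 l4) \<bullet> b)"
    unfolding eq
  proof (rule emeasure_lborel_box)
    fix b :: "real^4" assume "b \<in> Basis"
    then obtain i where b: "b = axis i 1" by (auto simp: Basis_vec_def)
    have "vec4 l1 l2 l3 l4 $ i \<le> vec4 u1 u2 u3 u4 $ i" using le by (simp add: vec4_def)
    then show "vec4 l1 l2 l3 l4 \<bullet> b \<le> vec4 u1 u2 u3 u4 \<bullet> b" by (simp add: b inner_axis)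
  qed
  also have "(\<Prod>b\<in>Basis. (vec4 u1 u2 u3 u4 - vec4 l1 l2 l3 l4) \<bullet> b) =
      (\<Prod>i\<in>UNIV. (vec4 u1 u2 u3 u4 - vec4 l1 l2 l3 l4) $ i)"
    by (simp add: Basis_vec_def cart_eq_inner_axis axis_eq_axis prod.UNION_disjoint)
  also have "\<dots> = (u1 - l1) * ((u2 - l2) * ((u3 - l3) * (u4 - l4)))"
    unfolding UNIV_4 by simp
  also have "ennreal \<dots> = emeasure lborel ({l1<..<u1} \<times> {l2<..<u2} \<times> {l3<..<u3} \<times> {l4<..<u4})"
    using le by (subst emeasure_lborel_Times, simp, simp add: borel_Times)+ (simp add: ennreal_mult)
  also have "{l1<..<u1} \<times> {l2<..<u2} \<times> {l3<..<u3} \<times> {l4<..<u4} = box l u"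
    by (simp add: l u box_prod)
  also have "emeasure lborel (box l u) = ennreal (\<Prod>b\<in>Basis. (u - l) \<bullet> b)"
    using lu by (rule emeasure_lborel_box)
  finally show "emeasure (distr lborel borel coords) (box l u) = ennreal (\<Prod>b\<in>Basis. (u - l) \<bullet> b)" .
qed simp


text \<open>After this rotation the planar slices of octahedra are squares with sides parallel to the axes.\<close>

definition rot34 :: "real^4 \<Rightarrow> real^4" where
  "rot34 x = vec4 (x$1) (x$2) ((x$3 + x$4) / sqrt 2) ((x$3 - x$4) / sqrt 2)"

lemma orthogonal_transformation_rot34: "orthogonal_transformation rot34"
  unfolding orthogonal_transformation
proof
  show "linear rot34"
    by (rule linearI) (auto simp: rot34_def vec4_eq_iff add_divide_distrib diff_divide_distrib algebra_simps)
  show "\<forall>v. norm (rot34 v) = norm v"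
  proof
    fix v
    have "(norm (rot34 v))\<^sup>2 = (norm v)\<^sup>2"
      unfolding norm_vec4 by (simp add: rot34_def power_divide power2_eq_square field_simps)
    then show "norm (rot34 v) = norm v" by simp
  qed
qed

lemma emeasure_vimage_coords_rot34:
  assumes A: "A \<in> sets borel"
  shows "(coords \<circ> rot34) -` A \<in> sets borel"
    "emeasure lborel ((coords \<circ> rot34) -` A) = emeasure lborel A"
proof -
  have s: "coords -` A \<in> sets borel" using measurable_sets[of coords borel borel A] A by simp
  show "(coords \<circ> rot34) -` A \<in> sets borel"
    using emeasure_orthogonal_vimage(1)[OF orthogonal_transformation_rot34 s] by (simp add: vimage_comp)
  have "emeasure lborel ((coords \<circ> rot34) -` A) = emeasure lborel (coords -` A)"
    using emeasure_orthogonal_vimage(2)[OF orthogonal_transformation_rot34 s] by (simp add: vimage_comp)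
  also have "\<dots> = emeasure lborel A"
    using A emeasure_distr[of coords lborel borel A] by (simp add: distr_lborel_coords)
  finally show "emeasure lborel ((coords \<circ> rot34) -` A) = emeasure lborel A" .
qed

definition l1 :: "real^4 \<Rightarrow> real" where "l1 x = \<bar>x$2\<bar> + \<bar>x$3\<bar> + \<bar>x$4\<bar>"

lemma abs_sum_less: "\<bar>x + y\<bar> < c \<Longrightarrow> \<bar>x - y\<bar> < c \<Longrightarrow> \<bar>x\<bar> + \<bar>y\<bar> < c" for x y c :: real
  by (cases "0 \<le> x"; cases "0 \<le> y") auto

lemma sqrt2_times_rot: "sqrt 2 * \<bar>(x + y) / sqrt 2\<bar> \<le> \<bar>x\<bar> + \<bar>y\<bar>" "sqrt 2 * \<bar>(x - y) / sqrt 2\<bar> \<le> \<bar>x\<bar> + \<bar>y\<bar>" for x y :: real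
  by (simp_all add: abs_divide)

text \<open>The slices at height \<open>h\<close> of the two cones that contain \<open>A\<close> are
  octahedra of radii \<open>2 - h\<close> and \<open>2 - y$1 + h\<close>. Their sum does not depend
  on \<open>h\<close>, so the same \<open>X\<close> serves for every slice, below and above the
  facet \<open>x$1 = 1\<close>.\<close>

lemma emeasure_slab_le:
  fixes y :: "real^4"
  assumes X: "\<And>h. emeasure lborel (diamond_overlap (2 - h) (2 - y$1 + h) (y$2) ((y$3 + y$4) / sqrt 2) ((y$3 - y$4) / sqrt 2)) \<le> ennreal X"
    and lu: "l \<le> u" "0 \<le> X"
    and A: "A \<subseteq> {x. l < x$1 \<and> x$1 < u \<and> l1 x < 2 - x$1 \<and> l1 (x - y) < 2 - y$1 + x$1}"
  shows "emeasure lborel A \<le> ennreal ((u - l) * X)"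
proof -
  let ?D = "\<lambda>h. diamond_overlap (2 - h) (2 - y$1 + h) (y$2) ((y$3 + y$4) / sqrt 2) ((y$3 - y$4) / sqrt 2)"
  define B where "B = {q. l < fst q \<and> fst q < u \<and> snd q \<in> ?D (fst q)}"
  have oB: "open B" unfolding B_def diamond_overlap_def mem_Collect_eq
    by (intro open_Collect_conj open_Collect_less continuous_intros)
  have sub: "A \<subseteq> (coords \<circ> rot34) -` B"
  proof
    fix x assume "x \<in> A"
    then have x: "l < x$1" "x$1 < u" "l1 x < 2 - x$1" "l1 (x - y) < 2 - y$1 + x$1" using A by auto
    have 1: "(x$3 + x$4) / sqrt 2 - (y$3 + y$4) / sqrt 2 = ((x$3 - y$3) + (x$4 - y$4)) / sqrt 2"
      "(x$3 - x$4) / sqrt 2 - (y$3 - y$4) / sqrt 2 = ((x$3 - y$3) - (x$4 - y$4)) / sqrt 2"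
      by (simp_all add: add_divide_distrib diff_divide_distrib)
    have 2: "\<bar>x$2\<bar> + sqrt 2 * \<bar>(x$3 + x$4) / sqrt 2\<bar> \<le> l1 x" "\<bar>x$2\<bar> + sqrt 2 * \<bar>(x$3 - x$4) / sqrt 2\<bar> \<le> l1 x"
      "\<bar>x$2 - y$2\<bar> + sqrt 2 * \<bar>(x$3 + x$4) / sqrt 2 - (y$3 + y$4) / sqrt 2\<bar> \<le> l1 (x - y)"
      "\<bar>x$2 - y$2\<bar> + sqrt 2 * \<bar>(x$3 - x$4) / sqrt 2 - (y$3 - y$4) / sqrt 2\<bar> \<le> l1 (x - y)"
      unfolding 1 l1_def add.assoc vector_minus_component
      by (intro add_left_mono sqrt2_times_rot)+
    show "x \<in> (coords \<circ> rot34) -` B"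
      using x(1,2) 2(1,2)[THEN le_less_trans, OF x(3)] 2(3,4)[THEN le_less_trans, OF x(4)]
      by (simp add: B_def coords_def rot34_def diamond_overlap_def)
  qed
  have "emeasure lborel A \<le> emeasure lborel ((coords \<circ> rot34) -` B)"
    by (rule emeasure_mono[OF sub]) (use emeasure_vimage_coords_rot34(1)[OF borel_open[OF oB]] in simp)
  also have "\<dots> = emeasure lborel B" by (rule emeasure_vimage_coords_rot34(2)[OF borel_open[OF oB]])
  also have "\<dots> = (\<integral>\<^sup>+h. emeasure lborel (Pair h -` B) \<partial>lborel)"
    by (rule emeasure_lborel_prod_eq[OF borel_open[OF oB]])
  also have "\<dots> \<le> (\<integral>\<^sup>+h. ennreal X * indicator {l<..<u} h \<partial>lborel)"
  proof (rule nn_integral_mono)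
    fix h
    have "Pair h -` B = (if h \<in> {l<..<u} then ?D h else {})" by (auto simp: B_def)
    then show "emeasure lborel (Pair h -` B) \<le> ennreal X * indicator {l<..<u} h"
      using X[of h] by (auto simp: indicator_def)
  qed
  also have "\<dots> = ennreal X * ennreal (u - l)" using lu by (simp add: nn_integral_cmult)
  also have "\<dots> = ennreal ((u - l) * X)" using lu by (simp add: ennreal_mult[symmetric] mult.commute)
  finally show ?thesis .
qed

text \<open>The part of the pyramid over the facet \<open>x$1 = 1\<close> up to height \<open>T\<close>; its corners are cut off so that it
  stays in the ball of radius \<open>sqrt 2\<close>, which no inactive neighbour can cut.\<close>

definition pyramid :: "real \<Rightarrow> (real^4) set" where
  "pyramid T = {x. 1 < x$1 \<and> x$1 < 1 + T \<and> \<bar>x$2\<bar> < 7/3 - 4/3 * x$1 \<and>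
     \<bar>x$3\<bar> + \<bar>x$4\<bar> < 7/3 - 4/3 * x$1 \<and> l1 x < 2 - x$1}"

lemma open_pyramid: "open (pyramid T)"
  unfolding pyramid_def l1_def by (intro open_Collect_conj open_Collect_less continuous_intros)

text \<open>The volume of a slice of the pyramid: an octahedron of radius \<open>m + e\<close> with
  its corners cut off at distance \<open>m\<close>. The integrand is the area of the square cut out
  at \<open>x$2 = u\<close>; the tents of height \<open>e\<close> correct for the cut corners of
  this square.\<close>

lemma clipped_tent_integral:
  assumes e: "0 \<le> e" "e \<le> m"
  shows "(\<integral>\<^sup>+u. ennreal (2 * (min m (m + e - \<bar>u\<bar>))\<^sup>2 * indicator {-m<..<m} u) \<partial>lborel)
    = ennreal (4/3 * m ^ 3 + 4 * m\<^sup>2 * e - 4/3 * e ^ 3)"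
proof -
  have *: "2 * (min m (m + e - \<bar>u\<bar>))\<^sup>2 * indicator {-m<..<m} u =
     2 * ((tent m 0 u)\<^sup>2 + 2 * e * tent m 0 u + e\<^sup>2 * indicator {-m<..<m} u - (tent e 0 u)\<^sup>2 - 2 * m * tent e 0 u)"
    (is "?l u = ?r u") for u
  proof (cases "\<bar>u\<bar> < m")
    case True
    then have i: "indicator {-m<..<m} u = (1::real)" and t: "tent m 0 u = m - \<bar>u\<bar>"
      by (auto simp: tent_def indicator_def abs_less_iff)
    show ?thesis
    proof (cases "\<bar>u\<bar> < e")
      case True
      then have m: "min m (m + e - \<bar>u\<bar>) = m" "tent e 0 u = e - \<bar>u\<bar>" by (auto simp: tent_def)
      show ?thesis unfolding i t m by algebra
    next
      case False
      then have m: "min m (m + e - \<bar>u\<bar>) = m + e - \<bar>u\<bar>" "tent e 0 u = 0" by (auto simp: tent_def)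
      have "(m + e - \<bar>u\<bar>)\<^sup>2 = (m - \<bar>u\<bar>)\<^sup>2 + 2 * e * (m - \<bar>u\<bar>) + e\<^sup>2" by algebra
      then show ?thesis unfolding i t m by simp
    qed
  next
    case False
    then have "u \<notin> {-m<..<m}" "tent m 0 u = 0" "tent e 0 u = 0" using e by (auto simp: tent_def)
    then show ?thesis by simp
  qed
  have m: "0 \<le> m" using e by simp
  have i: "has_bochner_integral lborel (indicator {-m<..<m}) (2 * m)"
    using has_bochner_integral_real_indicator[of "{-m<..<m}" lborel] m by (simp add: measure_def)
  have "has_bochner_integral lborel ?r (2 * (2/3 * m ^ 3 + 2 * e * m\<^sup>2 + e\<^sup>2 * (2 * m) - 2/3 * e ^ 3 - 2 * m * e\<^sup>2))"
    by (intro has_bochner_integral_mult_right has_bochner_integral_add has_bochner_integral_diff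
        tent_integral tent_square_integral i) (use e m in auto)
  then have "has_bochner_integral lborel ?l (2 * (2/3 * m ^ 3 + 2 * e * m\<^sup>2 + e\<^sup>2 * (2 * m) - 2/3 * e ^ 3 - 2 * m * e\<^sup>2))"
    unfolding * .
  then have "(\<integral>\<^sup>+u. ennreal (?l u) \<partial>lborel) = ennreal (2 * (2/3 * m ^ 3 + 2 * e * m\<^sup>2 + e\<^sup>2 * (2 * m) - 2/3 * e ^ 3 - 2 * m * e\<^sup>2))"
    by (rule nn_integral_has_bochner_integral) simp
  then show ?thesis by (simp add: algebra_simps power2_eq_square)
qed

text \<open>The term \<open>(1 - (1 - T) ^ 4) / 3\<close> is the volume up to height
  \<open>T\<close> without truncation, the integral of the octahedron volume
  \<open>4/3 * (2 - h) ^ 3\<close>. The other two terms account for the cut corners.\<close>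

lemma emeasure_pyramid_ge:
  assumes T: "0 \<le> T" "T \<le> 3/13"
  shows "ennreal ((1 - (1 - T) ^ 4) / 3 - 4/27 * T ^ 3 + 10/81 * T ^ 4) \<le> emeasure lborel (pyramid T)"
proof -
  define m where "m h = 7/3 - 4/3 * h" for h :: real
  \<comment> \<open>Chosen so that \<open>m h + e h\<close> is the radius \<open>2 - h\<close> of
    the uncut slice.\<close>
  define e where "e h = h / 3 - 1/3" for h :: real
  define B :: "(real \<times> real \<times> real \<times> real) set" where
    "B = {q. 1 < fst q \<and> fst q < 1 + T \<and> \<bar>fst (snd q)\<bar> < m (fst q) \<and>
       sqrt 2 * \<bar>fst (snd (snd q))\<bar> < min (m (fst q)) (2 - fst q - \<bar>fst (snd q)\<bar>) \<and>
       sqrt 2 * \<bar>snd (snd (snd q))\<bar> < min (m (fst q)) (2 - fst q - \<bar>fst (snd q)\<bar>)}"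
  have oB: "open B" unfolding B_def m_def
    by (intro open_Collect_conj open_Collect_less continuous_intros)
  have sub: "(coords \<circ> rot34) -` B \<subseteq> pyramid T"
  proof
    fix x assume x: "x \<in> (coords \<circ> rot34) -` B"
    have "sqrt 2 * \<bar>(x$3 + x$4) / sqrt 2\<bar> = \<bar>x$3 + x$4\<bar>" "sqrt 2 * \<bar>(x$3 - x$4) / sqrt 2\<bar> = \<bar>x$3 - x$4\<bar>"
      by (simp_all add: abs_divide)
    with x have "1 < x$1" "x$1 < 1 + T" "\<bar>x$2\<bar> < m (x$1)"
      and w: "\<bar>x$3 + x$4\<bar> < min (m (x$1)) (2 - x$1 - \<bar>x$2\<bar>)" "\<bar>x$3 - x$4\<bar> < min (m (x$1)) (2 - x$1 - \<bar>x$2\<bar>)"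
      by (auto simp: B_def coords_def rot34_def)
    moreover have "\<bar>x$3\<bar> + \<bar>x$4\<bar> < min (m (x$1)) (2 - x$1 - \<bar>x$2\<bar>)"
      using w by (rule abs_sum_less)
    ultimately show "x \<in> pyramid T"
      by (simp add: pyramid_def l1_def m_def)
  qed
  have slice: "emeasure lborel (Pair u -` Pair h -` B) = ennreal (2 * (min (m h) (m h + e h - \<bar>u\<bar>))\<^sup>2 * indicator {- m h<..<m h} u)"
    if h: "1 < h" "h < 1 + T" for h u
  proof (cases "\<bar>u\<bar> < m h")
    case False
    then have "Pair u -` Pair h -` B = {}" by (auto simp: B_def)
    then show ?thesis using False by (auto simp: indicator_def abs_less_iff)
  next
    case True
    define w where "w = min (m h) (m h + e h - \<bar>u\<bar>)"
    have "0 \<le> e h" using h by (simp add: e_def)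
    then have w0: "0 \<le> w" using True unfolding w_def by linarith
    have M: "m h + e h = 2 - h" by (simp add: m_def e_def field_simps)
    have sq: "sqrt 2 * \<bar>x\<bar> < w \<longleftrightarrow> x \<in> {- (w / sqrt 2)<..<w / sqrt 2}" for x
    proof -
      have "sqrt 2 * \<bar>x\<bar> < w \<longleftrightarrow> \<bar>x\<bar> < w / sqrt 2" by (simp add: field_simps)
      then show ?thesis by (auto simp: abs_less_iff)
    qed
    have mn: "min (m h) (2 - h - \<bar>u\<bar>) = w" by (simp add: w_def M)
    have "Pair u -` Pair h -` B = {- (w / sqrt 2)<..<w / sqrt 2} \<times> {- (w / sqrt 2)<..<w / sqrt 2}"
    proof (rule set_eqI)
      fix q :: "real \<times> real"
      show "q \<in> Pair u -` Pair h -` B \<longleftrightarrow> q \<in> {- (w / sqrt 2)<..<w / sqrt 2} \<times> {- (w / sqrt 2)<..<w / sqrt 2}"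
        unfolding vimage_eq B_def mem_Collect_eq fst_conv snd_conv mn sq mem_Times_iff
        using h True by simp
    qed
    moreover have "emeasure lborel {- (w / sqrt 2)<..<w / sqrt 2} = ennreal (2 * (w / sqrt 2))"
      using w0 by (subst emeasure_lborel_Ioo) auto
    ultimately have "emeasure lborel (Pair u -` Pair h -` B) = ennreal (2 * (w / sqrt 2)) * ennreal (2 * (w / sqrt 2))"
      by (simp only: emeasure_lborel_Times borel_open open_greaterThanLessThan)
    also have "\<dots> = ennreal (2 * (w / sqrt 2) * (2 * (w / sqrt 2)))"
      using w0 by (intro ennreal_mult[symmetric]) auto
    also have "2 * (w / sqrt 2) * (2 * (w / sqrt 2)) = 2 * w\<^sup>2 * indicator {- m h<..<m h} u"
      using True by (simp add: power2_eq_square abs_less_iff)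
    finally show ?thesis by (simp add: w_def)
  qed
  have slice3: "emeasure lborel (Pair h -` B) = ennreal (4/3 * (2 - h) ^ 3 - 4/9 * (h - 1)\<^sup>2 + 40/81 * (h - 1) ^ 3)"
    if h: "1 < h" "h < 1 + T" for h
  proof -
    have "Pair h -` B \<in> sets borel"
      by (intro borel_open open_vimage oB continuous_intros)
    then have "emeasure lborel (Pair h -` B) = (\<integral>\<^sup>+u. emeasure lborel (Pair u -` Pair h -` B) \<partial>lborel)"
      by (rule emeasure_lborel_prod_eq)
    also have "\<dots> = ennreal (4/3 * (m h) ^ 3 + 4 * (m h)\<^sup>2 * e h - 4/3 * (e h) ^ 3)"
    proof -
      have "0 \<le> e h" using h unfolding e_def by linarith
      moreover have "e h \<le> m h" using h T unfolding m_def e_def by linarith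
      ultimately show ?thesis by (simp only: slice[OF h] clipped_tent_integral)
    qed
    also have "4/3 * (m h) ^ 3 + 4 * (m h)\<^sup>2 * e h - 4/3 * (e h) ^ 3
        = 4/3 * (2 - h) ^ 3 - 4/9 * (h - 1)\<^sup>2 + 40/81 * (h - 1) ^ 3"
    proof -
      define k where "k = e h"
      have k: "h = 1 + 3 * k" unfolding k_def e_def by (simp add: field_simps)
      have mk: "m h = 1 - 4 * k" unfolding m_def k by (simp add: field_simps)
      show ?thesis unfolding mk k_def[symmetric] unfolding k
        by algebra
    qed
    finally show ?thesis .
  qed
  define F where "F h = - ((2 - h) ^ 4) / 3 - 4/27 * (h - 1) ^ 3 + 10/81 * (h - 1) ^ 4" for h :: real
  have "ennreal (F (1 + T) - F 1) = (\<integral>\<^sup>+h. ennreal (4/3 * (2 - h) ^ 3 - 4/9 * (h - 1)\<^sup>2 + 40/81 * (h - 1) ^ 3) * indicator {1..1 + T} h \<partial>lborel)"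
  proof (rule nn_integral_FTC_Icc[symmetric])
    show "(F has_real_derivative 4/3 * (2 - h) ^ 3 - 4/9 * (h - 1)\<^sup>2 + 40/81 * (h - 1) ^ 3) (at h)" for h
    proof -
      have "(F has_real_derivative - (4 * (2 - h) ^ 3 * (0 - 1)) / 3 - 4/27 * (3 * (h - 1)\<^sup>2 * (1 - 0))
          + 10/81 * (4 * (h - 1) ^ 3 * (1 - 0))) (at h)"
        unfolding F_def by (auto intro!: derivative_eq_intros)
      then show ?thesis by simp
    qed
    show "0 \<le> 4/3 * (2 - h) ^ 3 - 4/9 * (h - 1)\<^sup>2 + 40/81 * (h - 1) ^ 3" if h: "h \<in> {1..1 + T}" for h
    proof -
      have that: "1 \<le> h" "h \<le> 1 + T" using h by auto
      have "(h - 1)\<^sup>2 \<le> 1\<^sup>2" using that T by (intro power_mono) auto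
      moreover have "(3/4) ^ 3 \<le> (2 - h) ^ 3" using that T by (intro power_mono) auto
      moreover have "0 \<le> (h - 1) ^ 3" using that by simp
      ultimately show ?thesis by (simp add: power3_eq_cube)
    qed
  qed (use T in auto)
  also have "\<dots> = (\<integral>\<^sup>+h. emeasure lborel (Pair h -` B) \<partial>lborel)"
  proof (rule nn_integral_cong_AE)
    show "AE h in lborel. ennreal (4/3 * (2 - h) ^ 3 - 4/9 * (h - 1)\<^sup>2 + 40/81 * (h - 1) ^ 3) * indicator {1..1 + T} h
        = emeasure lborel (Pair h -` B)"
      using AE_lborel_singleton[of 1] AE_lborel_singleton[of "1 + T"]
    proof eventually_elim
      case (elim h)
      show ?case
      proof (cases "1 < h \<and> h < 1 + T")
        case True
        then show ?thesis using slice3[of h] by simp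
      next
        case False
        then have "Pair h -` B = {}" by (auto simp: B_def)
        then show ?thesis using False elim by (auto simp: indicator_def)
      qed
    qed
  qed
  also have "\<dots> = emeasure lborel B"
    by (rule emeasure_lborel_prod_eq[symmetric, OF borel_open[OF oB]])
  also have "\<dots> = emeasure lborel ((coords \<circ> rot34) -` B)"
    by (rule emeasure_vimage_coords_rot34(2)[symmetric, OF borel_open[OF oB]])
  also have "\<dots> \<le> emeasure lborel (pyramid T)"
    by (rule emeasure_mono[OF sub]) (use open_pyramid in auto)
  also have "F (1 + T) - F 1 = (1 - (1 - T) ^ 4) / 3 - 4/27 * T ^ 3 + 10/81 * T ^ 4"
    by (simp add: F_def field_simps)
  finally show ?thesis .
qed

section \<open>The 24-cell\<close>

definition cell24 :: "(real^4) set" where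
  "cell24 = {x. (\<forall>i. \<bar>x$i\<bar> < 1) \<and> (\<Sum>i\<in>UNIV. \<bar>x$i\<bar>) < 2}"

lemma cell24_iff: "x \<in> cell24 \<longleftrightarrow> \<bar>x$1\<bar> < 1 \<and> \<bar>x$2\<bar> < 1 \<and> \<bar>x$3\<bar> < 1 \<and> \<bar>x$4\<bar> < 1 \<and> \<bar>x$1\<bar> + l1 x < 2"
  by (auto simp: cell24_def forall_4 sum_4 l1_def)

lemma open_cell24: "open cell24"
  unfolding cell24_def forall_4 by (intro open_Collect_conj open_Collect_less continuous_intros)

lemma emeasure_reflect:
  fixes A :: "(real^4) set"
  assumes A: "A \<in> sets borel"
  shows "(\<lambda>x. c - x) -` A \<in> sets borel" "emeasure lborel ((\<lambda>x. c - x) -` A) = emeasure lborel A"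
proof -
  have [measurable]: "(\<lambda>x. c - x) \<in> borel_measurable borel" by simp
  show 1: "(\<lambda>x. c - x) -` A \<in> sets borel" using measurable_sets[of "\<lambda>x. c - x" borel borel A] A by simp
  have 2: "(\<lambda>x. c + x) -` A \<in> sets borel" using measurable_sets[of "\<lambda>x. c + x" borel borel A] A by simp
  have "emeasure lborel ((\<lambda>x. c - x) -` A) = emeasure lborel (uminus -` ((\<lambda>x. c + x) -` A))"
    by (simp add: vimage_def)
  also have "\<dots> = emeasure lborel ((\<lambda>x. c + x) -` A)"
    by (rule emeasure_orthogonal_vimage(2)) (use 2 orthogonal_transformation_neg[of "\<lambda>x::real^4. x"] in simp_all)
  also have "\<dots> = emeasure lborel A"
    using emeasure_distr[of "(+) c" lborel borel A] A by (simp add: lborel_distr_plus)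
  finally show "emeasure lborel ((\<lambda>x. c - x) -` A) = emeasure lborel A" .
qed

lemma hyperplane_null_set:
  fixes a :: "'a::euclidean_space"
  assumes "a \<noteq> 0"
  shows "{x. a \<bullet> x = b} \<in> null_sets lborel"
proof -
  have "{x. a \<bullet> x = b} \<in> sets lborel" using closed_hyperplane[of a b] by simp
  moreover have "{x. a \<bullet> x = b} \<in> null_sets lebesgue"
    using negligible_hyperplane[of a b] assms by (simp add: negligible_iff_null_sets)
  ultimately show ?thesis by (simp add: null_sets_def)
qed

text \<open>In every orthant the reflection in the centre of the unit cube exchanges the part of the cube
  below the facet of the cross polytope with the part above it, so the cell fills half of the cube.\<close>

lemma emeasure_cell24_ge: "ennreal 8 \<le> emeasure lborel cell24"
proof -
  define Sg where "Sg = {s :: real^4. \<forall>i. s$i = 1 \<or> s$i = -1}"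
  have sg4: "s \<in> Sg \<longleftrightarrow> (s$1 = 1 \<or> s$1 = -1) \<and> (s$2 = 1 \<or> s$2 = -1) \<and> (s$3 = 1 \<or> s$3 = -1) \<and> (s$4 = 1 \<or> s$4 = -1)" for s
    by (simp add: Sg_def forall_4)
  have fin: "finite Sg"
  proof (rule finite_subset)
    define E where "E = {1, -1 :: real}"
    show "Sg \<subseteq> (\<lambda>(a, b, c, d). vec4 a b c d) ` (E \<times> E \<times> E \<times> E)"
    proof
      fix s assume "s \<in> Sg"
      then have "s$i \<in> E" for i by (auto simp: Sg_def E_def)
      then have "(s$1, s$2, s$3, s$4) \<in> E \<times> E \<times> E \<times> E" by simp
      moreover have "s = (\<lambda>(a, b, c, d). vec4 a b c d) (s$1, s$2, s$3, s$4)" by (simp add: vec4_eq_iff)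
      ultimately show "s \<in> (\<lambda>(a, b, c, d). vec4 a b c d) ` (E \<times> E \<times> E \<times> E)" by (rule rev_image_eqI)
    qed
    show "finite ((\<lambda>(a, b, c, d). vec4 a b c d) ` (E \<times> E \<times> E \<times> E))" by (simp add: E_def)
  qed
  define Q where "Q = {x :: real^4. \<forall>i. \<bar>x$i\<bar> < 1}"
  define O' where "O' s = {x :: real^4. \<forall>i. 0 < s$i * x$i}" for s :: "real^4"
  define W where "W s = {x \<in> Q \<inter> O' s. 2 < (\<Sum>i\<in>UNIV. s$i * x$i)}" for s :: "real^4"
  have openO: "open (O' s)" for s
    unfolding O'_def forall_4 by (intro open_Collect_conj open_Collect_less continuous_intros)
  have absO: "\<bar>x$i\<bar> = s$i * x$i" if "x \<in> O' s" "s \<in> Sg" for x s i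
  proof -
    have "s$i = 1 \<or> s$i = -1" "0 < s$i * x$i" using that by (auto simp: O'_def Sg_def)
    then show ?thesis by auto
  qed
  have W: "W s = (\<lambda>x. s - x) -` (cell24 \<inter> O' s)" if s: "s \<in> Sg" for s
  proof -
    have eq: "s$i * (s$i - x$i) = 1 - s$i * x$i" for x i
    proof -
      have "s$i = 1 \<or> s$i = -1" using s by (simp add: Sg_def)
      then have "s$i * s$i = 1" by auto
      then show ?thesis by (simp add: right_diff_distrib)
    qed
    have O1: "s - x \<in> O' s \<longleftrightarrow> (\<forall>i. s$i * x$i < 1)" for x
      by (simp add: O'_def eq)
    show ?thesis
    proof (rule set_eqI)
      fix x
      show "x \<in> W s \<longleftrightarrow> x \<in> (\<lambda>x. s - x) -` (cell24 \<inter> O' s)"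
      proof (cases "\<forall>i. 0 < s$i * x$i \<and> s$i * x$i < 1")
        case True
        then have x: "x \<in> O' s" "s - x \<in> O' s" by (simp_all add: O1) (simp add: O'_def)
        have "\<bar>x$i\<bar> < 1" "\<bar>(s - x)$i\<bar> < 1" for i
          using True absO[OF x(1) s, of i] absO[OF x(2) s, of i] by (simp_all add: eq)
        moreover have "(\<Sum>i\<in>UNIV. \<bar>(s - x)$i\<bar>) = 4 - (\<Sum>i\<in>UNIV. s$i * x$i)"
          using absO[OF x(2) s] by (simp add: eq sum_4)
        ultimately show ?thesis using x by (simp add: W_def Q_def cell24_def)
      next
        case False
        have "\<not> x \<in> W s"
        proof
          assume "x \<in> W s"
          then have "x \<in> O' s" "x \<in> Q" by (auto simp: W_def)
          then show False using False absO[OF _ s, of x] by (auto simp: Q_def O'_def)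
        qed
        moreover have "\<not> (s - x \<in> cell24 \<and> s - x \<in> O' s)"
        proof
          assume A: "s - x \<in> cell24 \<and> s - x \<in> O' s"
          then have "\<bar>(s - x)$i\<bar> < 1" for i unfolding cell24_def by blast
          moreover have "\<bar>(s - x)$i\<bar> = s$i * (s - x)$i" for i using absO[of "s - x" s i] A s by blast
          ultimately have "s$i * (s - x)$i < 1" for i by metis
          then have "0 < s$i * x$i" for i by (simp add: eq)
          then show False using False A O1 by blast
        qed
        ultimately show ?thesis by simp
      qed
    qed
  qed
  \<comment> \<open>The boundaries of the orthants and the facet hyperplanes of the cross polytope,
    where the strict inequalities of the decomposition fail.\<close>
  define N where "N = (\<Union>i. {x :: real^4. axis i 1 \<bullet> x = 0}) \<union> (\<Union>s\<in>Sg. {x. s \<bullet> x = 2})"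
  have N: "N \<in> null_sets lborel"
  proof -
    have "s \<noteq> 0" if "s \<in> Sg" for s
    proof
      assume "s = 0" then show False using that by (simp add: sg4)
    qed
    then show ?thesis unfolding N_def
      by (intro null_sets.Un null_sets_UN' hyperplane_null_set) (auto simp: fin countable_finite axis_eq_0_iff)
  qed
  have sub: "Q \<subseteq> cell24 \<union> (\<Union>s\<in>Sg. W s) \<union> N"
  proof
    fix x assume x: "x \<in> Q"
    show "x \<in> cell24 \<union> (\<Union>s\<in>Sg. W s) \<union> N"
    proof (rule ccontr)
      assume n: "x \<notin> cell24 \<union> (\<Union>s\<in>Sg. W s) \<union> N"
      have nz: "x$i \<noteq> 0" for i
      proof
        assume "x$i = 0"
        then have "axis i 1 \<bullet> x = 0" by (simp add: inner_axis')
        then show False using n by (auto simp: N_def)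
      qed
      define s where "s = (\<chi> i. sgn (x$i))"
      have s: "s \<in> Sg" unfolding Sg_def s_def using nz by (auto simp: sgn_real_def)
      have xO: "x \<in> O' s" unfolding O'_def s_def using nz by (auto simp: sgn_real_def zero_less_mult_iff not_less le_less)
      have sx: "s \<bullet> x = (\<Sum>i\<in>UNIV. s$i * x$i)" by (simp add: inner_vec_def)
      have sm: "(\<Sum>i\<in>UNIV. \<bar>x$i\<bar>) = (\<Sum>i\<in>UNIV. s$i * x$i)" using absO[OF xO s] by simp
      consider "(\<Sum>i\<in>UNIV. \<bar>x$i\<bar>) < 2" | "(\<Sum>i\<in>UNIV. s$i * x$i) = 2" | "(\<Sum>i\<in>UNIV. s$i * x$i) > 2"
        using sm by linarith
      then show False
      proof cases
        case 1 then have "x \<in> cell24" using x by (simp add: cell24_def Q_def)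
        then show False using n by simp
      next
        case 2 then have "x \<in> N" using s sx unfolding N_def by auto
        then show False using n by simp
      next
        case 3 then have "x \<in> W s" using x xO by (simp add: W_def)
        then show False using n s by auto
      qed
    qed
  qed
  have Qbox: "Q = box (vec4 (-1) (-1) (-1) (-1)) (vec4 1 1 1 1)"
    by (auto simp: Q_def mem_box_cart forall_4 abs_less_iff)
  have cb: "cell24 \<inter> O' s \<in> sets borel" for s using open_cell24 openO by auto
  have Wb: "W s \<in> sets borel" if "s \<in> Sg" for s using emeasure_reflect(1)[OF cb] W[OF that] by simp
  have disj: "disjoint_family_on (\<lambda>s. cell24 \<inter> O' s) Sg"
    unfolding disjoint_family_on_def
  proof (intro ballI impI)
    fix s t assume st: "s \<in> Sg" "t \<in> Sg" "s \<noteq> t"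
    show "(cell24 \<inter> O' s) \<inter> (cell24 \<inter> O' t) = {}"
    proof (rule ccontr)
      assume "(cell24 \<inter> O' s) \<inter> (cell24 \<inter> O' t) \<noteq> {}"
      then obtain x where x: "x \<in> O' s" "x \<in> O' t" by auto
      have "s$i = t$i" for i
      proof -
        have "s$i * x$i = t$i * x$i" 
          by (rule trans[OF absO[OF x(1) st(1), symmetric] absO[OF x(2) st(2)]])
        moreover have "0 < s$i * x$i" using x(1) unfolding O'_def by blast
        ultimately show ?thesis by (metis less_irrefl mult_right_cancel mult_zero_right)
      qed
      then show False using st by (simp add: vec_eq_iff)
    qed
  qed
  have cb24: "cell24 \<in> sets borel" using open_cell24 by simp
  have Ub: "(\<Union>s\<in>Sg. W s) \<in> sets borel" using Wb fin by (intro sets.finite_UN) auto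
  have Nb: "N \<in> sets borel" using null_setsD2[OF N] by simp
  have "ennreal 16 = emeasure lborel Q"
  proof -
    have "emeasure lborel Q = ennreal (\<Prod>b\<in>Basis. (vec4 1 1 1 1 - vec4 (-1) (-1) (-1) (-1)) \<bullet> b)"
      unfolding Qbox by (rule emeasure_lborel_box) (auto simp: Basis_vec_def inner_axis vec4_def)
    also have "(\<Prod>b\<in>Basis. (vec4 1 1 1 1 - vec4 (-1) (-1) (-1) (-1)) \<bullet> b) =
      (\<Prod>i\<in>UNIV. (vec4 1 1 1 1 - vec4 (-1) (-1) (-1) (-1)) $ i)"
      by (simp add: Basis_vec_def cart_eq_inner_axis axis_eq_axis prod.UNION_disjoint)
    also have "\<dots> = 16" unfolding UNIV_4 by simp
    finally show ?thesis by simp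
  qed
  also have "\<dots> \<le> emeasure lborel (cell24 \<union> (\<Union>s\<in>Sg. W s) \<union> N)"
    using cb24 Ub Nb by (intro emeasure_mono sub) simp
  also have "\<dots> = emeasure lborel (cell24 \<union> (\<Union>s\<in>Sg. W s))"
    using cb24 Ub N by (intro emeasure_Un_null_set) simp_all
  also have "\<dots> \<le> emeasure lborel cell24 + emeasure lborel (\<Union>s\<in>Sg. W s)"
    using cb24 Ub by (intro emeasure_subadditive) simp_all
  also have "emeasure lborel (\<Union>s\<in>Sg. W s) \<le> (\<Sum>s\<in>Sg. emeasure lborel (W s))"
    using Wb fin by (intro emeasure_subadditive_finite) auto
  also have "\<dots> = (\<Sum>s\<in>Sg. emeasure lborel (cell24 \<inter> O' s))"
    by (intro sum.cong refl) (simp only: W emeasure_reflect(2)[OF cb])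
  also have "\<dots> = emeasure lborel (\<Union>s\<in>Sg. cell24 \<inter> O' s)"
    using cb fin disj by (intro sum_emeasure) auto
  also have "\<dots> \<le> emeasure lborel cell24"
    using cb24 by (intro emeasure_mono) auto
  finally have "ennreal 16 \<le> emeasure lborel cell24 + emeasure lborel cell24" by (simp add: add_left_mono)
  then show ?thesis
    by (cases "emeasure lborel cell24") (auto simp: ennreal_plus[symmetric] top_unique simp del: ennreal_plus)
qed

section \<open>Points near a centre\<close>

text \<open>The Hurwitz units form a root system of type \<open>D\<^sub>4\<close>, here an isometric copy of the root directions
  in which the facet of the 24-cell towards the deviating neighbour is orthogonal to the first axis.\<close>

definition hurwitz_roots :: "(real^4) set" where
  "hurwitz_roots = {\<gamma>. (\<exists>i. \<gamma> = axis i 1 \<or> \<gamma> = - axis i 1) \<or> (\<forall>i. \<bar>\<gamma>$i\<bar> = 1/2)}"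

text \<open>Applied to the position \<open>z\<close> of another centre relative to the given one,
  this records all that is kept of a centre that does not deviate: it is inactive, or it lies on a
  root ray at distance at least 2.\<close>

definition far_or_root :: "(real^4) set \<Rightarrow> real^4 \<Rightarrow> bool" where
  "far_or_root R z \<longleftrightarrow> 8 \<le> (norm z)\<^sup>2 \<or> (\<exists>t \<gamma>. 2 \<le> t \<and> \<gamma> \<in> R \<and> z = t *\<^sub>R \<gamma>)"

lemma norm_hurwitz_root: "\<gamma> \<in> hurwitz_roots \<Longrightarrow> norm \<gamma> = 1"
proof -
  assume "\<gamma> \<in> hurwitz_roots"
  then consider i where "\<gamma> = axis i 1" | i where "\<gamma> = - axis i 1" | "\<forall>i. \<bar>\<gamma>$i\<bar> = 1/2"
    by (auto simp: hurwitz_roots_def)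
  then show ?thesis
  proof cases
    case 3
    have "(\<gamma>$i)\<^sup>2 = 1/4" for i
    proof -
      have "(\<gamma>$i)\<^sup>2 = \<bar>\<gamma>$i\<bar>\<^sup>2" by simp
      then show ?thesis using 3 by (simp add: power2_eq_square)
    qed
    then have "(norm \<gamma>)\<^sup>2 = 1/4 + 1/4 + 1/4 + 1/4" unfolding norm_vec4 by presburger
    then have "(norm \<gamma>)\<^sup>2 = 1\<^sup>2" by simp
    then show ?thesis by (simp only: power2_eq_iff_nonneg norm_ge_zero zero_le_one)
  qed (simp_all add: norm_axis_1)
qed

lemma closer_if_far:
  fixes x z :: "'a::real_inner"
  assumes "(norm x)\<^sup>2 < 2" "8 \<le> (norm z)\<^sup>2"
  shows "norm x < norm (x - z)"
proof -
  have "2 * norm x < norm z"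
    by (rule power2_less_imp_less) (use assms in \<open>simp_all add: power_mult_distrib\<close>)
  then show ?thesis using norm_triangle_ineq2[of z x] by (simp add: norm_minus_commute)
qed

lemma closer_if_multiple:
  fixes x \<gamma> :: "'a::real_inner"
  assumes "norm \<gamma> = 1" "\<gamma> \<bullet> x < t / 2" "0 < t"
  shows "norm x < norm (x - t *\<^sub>R \<gamma>)"
proof (rule power2_less_imp_less)
  have "(norm (x - t *\<^sub>R \<gamma>))\<^sup>2 = (norm x)\<^sup>2 + t * (t - 2 * (\<gamma> \<bullet> x))"
    using assms(1) unfolding power2_norm_eq_inner norm_eq_1
    by (simp add: inner_diff_left inner_diff_right inner_commute algebra_simps)
  moreover have "0 < t * (t - 2 * (\<gamma> \<bullet> x))" using assms by simp
  ultimately show "(norm x)\<^sup>2 < (norm (x - t *\<^sub>R \<gamma>))\<^sup>2" by simp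
qed simp

text \<open>Stated so that it covers the cell and the pyramid together: passing beyond the facet
  \<open>x$1 = 1\<close> violates the inequality of the root \<open>axis 1 1\<close> only. The roots
  with all coordinates of absolute value 1/2 are controlled by the cross polytope condition, which
  the pyramid retains.\<close>

lemma inner_hurwitz_le:
  assumes "\<gamma> \<in> hurwitz_roots" and "\<bar>x$2\<bar> < 1" "\<bar>x$3\<bar> < 1" "\<bar>x$4\<bar> < 1" "\<bar>x$1\<bar> + l1 x < 2"
    and "x$1 < 1 \<or> \<gamma> \<noteq> axis 1 1" "-1 < x$1"
  shows "\<gamma> \<bullet> x < 1"
proof -
  consider i where "\<gamma> = axis i 1" | i where "\<gamma> = - axis i 1" | "\<forall>i. \<bar>\<gamma>$i\<bar> = 1/2"
    using assms(1) by (auto simp: hurwitz_roots_def)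
  then show ?thesis
  proof cases
    case 1
    then have "\<gamma> \<bullet> x = x$i" by (simp add: inner_axis')
    then show ?thesis using assms 1 exhaust_4[of i] by auto
  next
    case 2
    then have "\<gamma> \<bullet> x = - x$i" by (simp add: inner_axis')
    then show ?thesis using assms 2 exhaust_4[of i] by auto
  next
    case 3
    have "\<gamma>$i * x$i \<le> \<bar>x$i\<bar> / 2" for i
    proof -
      have "\<gamma>$i * x$i \<le> \<bar>\<gamma>$i\<bar> * \<bar>x$i\<bar>" by (metis abs_ge_self abs_mult)
      then show ?thesis using 3 by simp
    qed
    then have "\<gamma> \<bullet> x \<le> \<bar>x$1\<bar> / 2 + \<bar>x$2\<bar> / 2 + \<bar>x$3\<bar> / 2 + \<bar>x$4\<bar> / 2"
      unfolding inner_vec_def sum_4 inner_real_def by (intro add_mono)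
    then show ?thesis using assms(5) by (simp add: l1_def)
  qed
qed

lemma norm_cell24:
  assumes "x \<in> cell24" shows "(norm x)\<^sup>2 < 2"
proof -
  have "(x$i)\<^sup>2 \<le> \<bar>x$i\<bar>" for i
  proof -
    have "\<bar>x$i\<bar> * \<bar>x$i\<bar> \<le> \<bar>x$i\<bar> * 1" using assms by (intro mult_left_mono) (auto simp: cell24_def less_imp_le)
    then show ?thesis by (simp add: power2_eq_square)
  qed
  then have "(norm x)\<^sup>2 \<le> \<bar>x$1\<bar> + \<bar>x$2\<bar> + \<bar>x$3\<bar> + \<bar>x$4\<bar>"
    unfolding norm_vec4 by (intro add_mono)
  also have "\<dots> < 2" using assms by (simp add: cell24_iff l1_def)
  finally show ?thesis .
qed

text \<open>In a slice the farthest possible corner has \<open>u = m\<close> and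
  \<open>w = e\<close>, which gives the squared norm \<open>2 - 2 * e * (1 - 13 * e)\<close>. The
  slope 4/3 of the truncation makes the linear term negative, and \<open>13 * e < 1\<close> is the
  origin of the height bound 3/13.\<close>

lemma norm_pyramid:
  assumes x: "x \<in> pyramid T" and T: "T \<le> 3/13"
  shows "(norm x)\<^sup>2 < 2"
proof -
  define n e m u w where "n = x$1 - 1" and "e = n / 3" and "m = 1 - 4 * e" and "u = \<bar>x$2\<bar>" and "w = \<bar>x$3\<bar> + \<bar>x$4\<bar>"
  have n: "x$1 = 1 + 3 * e" by (simp add: n_def e_def field_simps)
  have b: "0 < e" "13 * e < 1" "u < m" "w < m" "u + w < m + e"
    using x T by (simp_all add: pyramid_def l1_def u_def w_def m_def n field_simps)
  have uw: "0 \<le> u" "0 \<le> w" by (auto simp: u_def w_def)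
  have "(x$3)\<^sup>2 + (x$4)\<^sup>2 \<le> w\<^sup>2"
  proof -
    have "w\<^sup>2 = (x$3)\<^sup>2 + (x$4)\<^sup>2 + 2 * (\<bar>x$3\<bar> * \<bar>x$4\<bar>)" by (simp add: w_def power2_sum)
    then show ?thesis by simp
  qed
  moreover have "u\<^sup>2 + w\<^sup>2 < m\<^sup>2 + e\<^sup>2"
  proof (cases "u + w < m")
    case True
    have "(u + w)\<^sup>2 < m\<^sup>2" using True uw by (intro power_strict_mono) auto
    moreover have "u\<^sup>2 + w\<^sup>2 \<le> (u + w)\<^sup>2" using uw by (simp add: power2_sum)
    ultimately show ?thesis using zero_le_power2[of e] by linarith
  next
    case False
    have "0 < (m - u) * (m - w)" using b by simp
    then have "u\<^sup>2 + w\<^sup>2 < (u + w - m)\<^sup>2 + m\<^sup>2" by (simp add: power2_eq_square algebra_simps)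
    moreover have "(u + w - m)\<^sup>2 \<le> e\<^sup>2" using False b by (intro power_mono) auto
    ultimately show ?thesis by linarith
  qed
  moreover have "(x$1)\<^sup>2 + (m\<^sup>2 + e\<^sup>2) \<le> 2"
  proof -
    have "(x$1)\<^sup>2 + (m\<^sup>2 + e\<^sup>2) = 2 - 2 * e * (1 - 13 * e)" unfolding n m_def by algebra
    moreover have "0 \<le> 2 * e * (1 - 13 * e)" using b by simp
    ultimately show ?thesis by linarith
  qed
  moreover have "(x$2)\<^sup>2 = u\<^sup>2" by (simp add: u_def)
  ultimately show ?thesis unfolding norm_vec4 by linarith
qed

lemma cell24_closer:
  assumes x: "x \<in> cell24" and z: "far_or_root hurwitz_roots z"
  shows "norm x < norm (x - z)"
  using z unfolding far_or_root_def
proof (elim disjE exE conjE)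
  assume "8 \<le> (norm z)\<^sup>2" then show ?thesis using closer_if_far norm_cell24[OF x] by blast
next
  fix t \<gamma> assume t: "2 \<le> t" "\<gamma> \<in> hurwitz_roots" "z = t *\<^sub>R \<gamma>"
  have "\<gamma> \<bullet> x < 1" using x t by (intro inner_hurwitz_le) (auto simp: cell24_iff)
  then show ?thesis using t closer_if_multiple[of \<gamma> x t] norm_hurwitz_root[OF t(2)] by simp
qed

lemma pyramid_closer:
  assumes x: "x \<in> pyramid T" and T: "T \<le> 3/13" and z: "far_or_root hurwitz_roots z"
    and ax: "\<And>t. 2 \<le> t \<Longrightarrow> z = t *\<^sub>R axis 1 1 \<Longrightarrow> 2 * (1 + T) \<le> t"
  shows "norm x < norm (x - z)"
  using z unfolding far_or_root_def
proof (elim disjE exE conjE)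
  assume "8 \<le> (norm z)\<^sup>2" then show ?thesis using closer_if_far norm_pyramid[OF x T] by blast
next
  fix t \<gamma> assume t: "2 \<le> t" "\<gamma> \<in> hurwitz_roots" "z = t *\<^sub>R \<gamma>"
  have "\<gamma> \<bullet> x < t / 2"
  proof (cases "\<gamma> = axis 1 1")
    case True
    then have "\<gamma> \<bullet> x = x$1" by (simp add: inner_axis')
    then show ?thesis using x ax[OF t(1)] t True by (auto simp: pyramid_def)
  next
    case False
    have "\<gamma> \<bullet> x < 1" using x t False by (intro inner_hurwitz_le) (auto simp: pyramid_def l1_def)
    then show ?thesis using t by simp
  qed
  then show ?thesis using t closer_if_multiple[of \<gamma> x t] norm_hurwitz_root[OF t(2)] by simp
qed

section \<open>The region of a pair of deviating neighbours\<close>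

text \<open>Replacing \<open>(b, c)\<close> by the single number \<open>e = b + c\<close> does not
  decrease the sum of squares. The circle of radius \<open>D\<close> meets the line
  \<open>a + e = 23/17 * D\<close> at \<open>a = 8/17 * D\<close> and \<open>a = 15/17 * D\<close>,
  and between these points the line runs inside the circle.\<close>

lemma dominant_coordinate_or_sum:
  fixes a b c D :: real
  assumes "0 \<le> b" "0 \<le> c" "b \<le> a" "c \<le> a" "0 \<le> D" and q: "D\<^sup>2 \<le> a\<^sup>2 + b\<^sup>2 + c\<^sup>2"
  shows "15/17 * D \<le> a \<or> 23/17 * D \<le> a + (b + c)"
proof (rule ccontr)
  assume "\<not> ?thesis"
  then have a: "a < 15/17 * D" and s: "a + (b + c) < 23/17 * D" by auto
  define e where "e = b + c"
  have e0: "0 \<le> e" "0 \<le> a" using assms by (auto simp: e_def)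
  have D0: "0 < D" using a e0 by simp
  have e2: "b\<^sup>2 + c\<^sup>2 \<le> e\<^sup>2" using assms by (simp add: e_def power2_sum)
  show False
  proof (cases "e \<le> a")
    case True
    have le: "D\<^sup>2 \<le> a\<^sup>2 + e\<^sup>2" using q e2 by linarith
    show False
    proof (cases "a \<le> 8/17 * D")
      case True
      have "a\<^sup>2 \<le> (8/17 * D)\<^sup>2" using True e0 by (intro power_mono) auto
      moreover have "e\<^sup>2 \<le> a\<^sup>2" using \<open>e \<le> a\<close> e0 by (intro power_mono) auto
      ultimately have "D\<^sup>2 \<le> 2 * (8/17 * D)\<^sup>2" using le by linarith
      then show False using D0 by (simp add: power2_eq_square)
    next
      case False
      have "e\<^sup>2 < (23/17 * D - a)\<^sup>2" using s e0 by (intro power_strict_mono) (auto simp: e_def)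
      moreover have "a\<^sup>2 + (23/17 * D - a)\<^sup>2 = D\<^sup>2 - 2 * ((a - 8/17 * D) * (15/17 * D - a))" by algebra
      moreover have "0 < (a - 8/17 * D) * (15/17 * D - a)" using False a by simp
      ultimately show False using le by linarith
    qed
  next
    case False
    \<comment> \<open>When \<open>e\<close> exceeds \<open>a\<close>, the bounds
      \<open>b \<le> a\<close> and \<open>c \<le> a\<close> already give
      \<open>2 * D\<^sup>2 \<le> (a + e)\<^sup>2\<close>, and 2 is larger than the square of
      23/17.\<close>
    have "b * b \<le> a * b" "c * c \<le> a * c" using assms by (auto intro: mult_right_mono)
    moreover have "a * a \<le> a * e" using False e0 by (intro mult_left_mono) auto
    moreover have "0 \<le> b * c" using assms by simp
    ultimately have "2 * D\<^sup>2 \<le> (a + (b + c))\<^sup>2"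
      using q unfolding e_def by (simp add: power2_eq_square algebra_simps)
    also have "\<dots> \<le> (23/17 * D)\<^sup>2" using s e0 by (intro power_mono) (auto simp: e_def)
    finally show False using D0 by (simp add: power2_eq_square)
  qed
qed

lemma fmeasurable_open_bounded:
  fixes A :: "(real^4) set"
  assumes "A \<in> sets borel" "\<And>x. x \<in> A \<Longrightarrow> (norm x)\<^sup>2 < 2"
  shows "A \<in> fmeasurable lborel"
proof -
  have "A \<subseteq> ball 0 2"
  proof
    fix x assume "x \<in> A"
    then have "(norm x)\<^sup>2 < 2\<^sup>2" using assms(2)[of x] by simp
    then show "x \<in> ball 0 2" using power2_less_imp_less[of "norm x" 2] by simp
  qed
  then have "bounded A" by (rule bounded_subset[OF bounded_ball])
  then show ?thesis using assms(1) emeasure_bounded_finite[of A] by (intro fmeasurableI) auto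
qed

text \<open>The hypotheses make \<open>axis 1 1\<close> a Hurwitz root nearest to \<open>y\<close>
  and \<open>y$2\<close> the largest of the other coordinates. The set \<open>A\<close> is the part
  built around the centre 0, and its reflection the part around \<open>y\<close>. The comparison
  with \<open>y\<close> itself is left out here, since it is settled by halving the union.\<close>

lemma pair_region:
  fixes y :: "real^4"
  assumes y: "0 \<le> y$3" "0 \<le> y$4" "y$3 \<le> y$2" "y$4 \<le> y$2" "y$2 + y$3 + y$4 \<le> y$1"
    and ny: "2 \<le> norm y"
  obtains A :: "(real^4) set" where "A \<in> sets borel" "\<And>x. x \<in> A \<Longrightarrow> (norm x)\<^sup>2 < 2"
    "\<And>x z. x \<in> A \<Longrightarrow> far_or_root hurwitz_roots z \<Longrightarrow> 2 \<le> norm (z - y) \<Longrightarrow> norm x < norm (x - z)"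
    "16 \<le> measure lborel (A \<union> (\<lambda>x. y - x) -` A)"
proof -
  define p a e where "p = y$1" and "a = y$2" and "e = y$3 + y$4"
  define K' where "K' = (\<lambda>x. y - x) -` cell24"
  have Kb: "cell24 \<in> sets borel" using open_cell24 by simp
  have Kf: "cell24 \<in> fmeasurable lborel" using fmeasurable_open_bounded[OF Kb norm_cell24] .
  have refl: "(\<lambda>x. y - x) -` A \<in> fmeasurable lborel \<and> measure lborel ((\<lambda>x. y - x) -` A) = measure lborel A"
    if "A \<in> fmeasurable lborel" for A
    using that emeasure_reflect[of A y] by (auto simp: fmeasurable_def measure_def)
  have K8: "8 \<le> measure lborel cell24"
    using emeasure_cell24_ge Kf by (simp add: emeasure_eq_measure2)
  have K'f: "K' \<in> fmeasurable lborel" and K'm: "measure lborel K' = measure lborel cell24"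
    using refl[OF Kf] by (auto simp: K'_def)
  have K'p: "p - 1 < x$1" "x$1 < p + 1" "l1 (x - y) < 2 - p + x$1" if "x \<in> K'" for x
  proof -
    have "\<bar>p - x$1\<bar> < 1" "\<bar>p - x$1\<bar> + l1 (y - x) < 2" using that by (auto simp: K'_def cell24_iff p_def)
    moreover have "l1 (y - x) = l1 (x - y)" by (simp add: l1_def abs_minus_commute)
    ultimately show "p - 1 < x$1" "x$1 < p + 1" "l1 (x - y) < 2 - p + x$1" by linarith+
  qed
  have Kp: "x$1 < 1" "l1 x < 2 - x$1" if "x \<in> cell24" for x
    using that by (auto simp: cell24_iff)
  have a0: "0 \<le> a" "0 \<le> e" "a + e \<le> p" using y by (auto simp: a_def e_def p_def)
  have q: "(norm y)\<^sup>2 = p\<^sup>2 + (a\<^sup>2 + (y$3)\<^sup>2 + (y$4)\<^sup>2)" by (simp add: norm_vec4 p_def a_def)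
  have "2\<^sup>2 \<le> (norm y)\<^sup>2" using ny by (intro power_mono) auto
  then have q4: "4 \<le> p\<^sup>2 + (a\<^sup>2 + (y$3)\<^sup>2 + (y$4)\<^sup>2)" using q by simp
  \<comment> \<open>With \<open>q4\<close> this gives \<open>p\<^sup>2 \<ge> 2\<close>. It also
    keeps a third centre on the first axis away from \<open>y\<close>, because the orthogonal part
    of \<open>y\<close> is not longer than \<open>p\<close>.\<close>
  have qS: "a\<^sup>2 + (y$3)\<^sup>2 + (y$4)\<^sup>2 \<le> p\<^sup>2"
  proof -
    have "a\<^sup>2 + (y$3)\<^sup>2 + (y$4)\<^sup>2 \<le> (a + e)\<^sup>2"
      using y a0 by (simp add: e_def power2_eq_square algebra_simps add_nonneg_nonneg)
    also have "\<dots> \<le> p\<^sup>2" using a0 by (intro power_mono) auto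
    finally show ?thesis .
  qed
  show thesis
  proof (cases "2 \<le> p")
    case True
    \<comment> \<open>The two cells lie on opposite sides of the hyperplane \<open>x$1 = 1\<close>,
      so nothing is lost.\<close>
    have "cell24 \<inter> K' = {}" using Kp(1) K'p(1) True by fastforce
    then have "measure lborel (cell24 \<union> K') = measure lborel cell24 + measure lborel K'"
      by (simp add: measure_Un3[OF Kf K'f])
    then have "16 \<le> measure lborel (cell24 \<union> K')" using K8 K'm by simp
    then show thesis using that[of cell24] Kb norm_cell24 cell24_closer unfolding K'_def by blast
  next
    case False
    \<comment> \<open>No centre lies on the positive first axis nearer than \<open>p + D\<close>, so
      the height \<open>(D - (2 - p)) / 2\<close> above the facet is free. Only 8/15 of it is used,
      which keeps \<open>T\<close> below 3/13 and hence the pyramid in the ball of radius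
      \<open>sqrt 2\<close>.\<close>
    define D T r z X where "D = sqrt (4 - p\<^sup>2)" and "T = 4/15 * (D - (2 - p))" and "r = 2 - p / 2"
      and "z = r - (a + e) / 2" and "X = min (4/3 * (r - a / 2) ^ 3) (2/3 * r * z * (r + z))"
    have p: "0 \<le> p" "p < 2" "2 \<le> p\<^sup>2" using a0 False q4 qS by auto
    have "p\<^sup>2 \<le> 2\<^sup>2" using p by (intro power_mono) auto
    then have D: "0 \<le> D" "D\<^sup>2 = 4 - p\<^sup>2" by (simp_all add: D_def)
    have dD: "2 - p \<le> D"
    proof (rule power2_le_imp_le)
      have "(2 - p) * (2 - p) \<le> (2 - p) * (2 + p)" using p by (intro mult_left_mono) auto
      then show "(2 - p)\<^sup>2 \<le> D\<^sup>2" unfolding D by (simp add: power2_eq_square algebra_simps)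
    qed fact
    have T0: "0 \<le> T" using dD by (simp add: T_def)
    have T1: "T \<le> 3/13"
    proof -
      \<comment> \<open>The sum \<open>D + p\<close> is at most \<open>2 * sqrt 2\<close>, and
        143/50 is a rational bound slightly above that.\<close>
      have "(D + p)\<^sup>2 \<le> 2 * (D\<^sup>2 + p\<^sup>2)" using zero_le_power2[of "D - p"] by (simp add: power2_eq_square algebra_simps)
      also have "\<dots> = 8" using D by simp
      also have "8 \<le> (143/50 :: real)\<^sup>2" by (simp add: power2_eq_square)
      finally have "D + p \<le> 143/50" by (rule power2_le_imp_le) simp
      then show ?thesis by (simp add: T_def)
    qed
    have z0: "0 \<le> z" and r0: "0 \<le> r" "0 \<le> r - a / 2" using a0 p by (auto simp: z_def r_def)
    have X0: "0 \<le> X" using z0 r0 by (simp add: X_def)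
    have ov: "emeasure lborel (diamond_overlap (2 - h) (2 - y$1 + h) (y$2) ((y$3 + y$4) / sqrt 2) ((y$3 - y$4) / sqrt 2)) \<le> ennreal X" for h
    proof -
      have 1: "r = (2 - h + (2 - y$1 + h)) / 2" by (simp add: r_def p_def)
      have 2: "z = r - (y$2 + sqrt 2 * ((y$3 + y$4) / sqrt 2)) / 2" by (simp add: z_def a_def e_def)
      have 3: "0 \<le> y$2" "0 \<le> (y$3 + y$4) / sqrt 2" using a0 by (auto simp: a_def e_def)
      show ?thesis
        using diamond_overlap_bounds[OF 3 1 2 z0, of "(y$3 - y$4) / sqrt 2"] by (simp add: X_def a_def min_def)
    qed
    note slab = emeasure_slab_le[OF ov _ X0]
    define B where "B = pyramid T"
    have Bb: "B \<in> sets borel" using open_pyramid by (simp add: B_def)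
    have Bf: "B \<in> fmeasurable lborel" using fmeasurable_open_bounded[OF Bb] norm_pyramid T1 by (auto simp: B_def)
    define B' where "B' = (\<lambda>x. y - x) -` B"
    have Bp: "1 < x$1" "x$1 < 1 + T" "l1 x < 2 - x$1" if "x \<in> B" for x
      using that by (auto simp: B_def pyramid_def)
    have B'p: "x$1 < p - 1" if "x \<in> B'" for x using that by (auto simp: B'_def B_def pyramid_def p_def)
    have KK: "measure lborel (cell24 \<inter> K') \<le> (2 - p) * X"
    proof -
      have "emeasure lborel (cell24 \<inter> K') \<le> ennreal ((1 - (p - 1)) * X)"
        by (rule slab) (use p Kp K'p in \<open>auto simp: p_def\<close>)
      then show ?thesis using Kf K'f p X0 by (simp add: emeasure_eq_measure2 fmeasurable.Int)
    qed
    have BK: "measure lborel (B \<inter> K') \<le> T * X"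
    proof -
      have "emeasure lborel (B \<inter> K') \<le> ennreal ((1 + T - 1) * X)"
        by (rule slab) (use T0 Bp K'p in \<open>auto simp: p_def\<close>)
      then show ?thesis using Bf K'f T0 X0 by (simp add: emeasure_eq_measure2 fmeasurable.Int)
    qed
    have BT: "(1 - (1 - T) ^ 4) / 3 - 4/27 * T ^ 3 + 10/81 * T ^ 4 \<le> measure lborel B"
      using emeasure_pyramid_ge[OF T0 T1] Bf by (simp add: emeasure_eq_measure2 B_def)
    \<comment> \<open>Twice this inequality is the balance: the two pyramids outweigh the overlap of
      the cells, at most \<open>(2 - p) * X\<close>, together with their own parts inside the
      opposite cells, at most \<open>T * X\<close> each.\<close>
    have key: "(T + (2 - p) / 2) * X \<le> measure lborel B"
    proof (rule order_trans[OF slice_polynomial_bound[OF p(1,3,2) D T_def r_def z_def a0(1,3,2)] BT])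
      show "15/17 * D \<le> a \<or> 23/17 * D \<le> a + e"
        unfolding e_def by (rule dominant_coordinate_or_sum) (use y D q4 in \<open>auto simp: a_def\<close>)
    qed (auto simp: X_def)
    define S where "S = (cell24 \<union> B) \<union> (\<lambda>x. y - x) -` (cell24 \<union> B)"
    have S: "S = (cell24 \<union> K') \<union> ((B - K') \<union> (\<lambda>x. y - x) -` (B - K'))"
      by (auto simp: S_def K'_def B_def)
    have BKf: "B - K' \<in> fmeasurable lborel" by (rule fmeasurable_Diff[OF Bf fmeasurableD[OF K'f]])
    let ?R = "(\<lambda>x. y - x) -` (B - K')"
    have Rf: "?R \<in> fmeasurable lborel" and Rm: "measure lborel ?R = measure lborel (B - K')"
      using refl[OF BKf] by auto
    have "(B - K') \<inter> ?R = {}"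
      using Bp(1) B'p p by (fastforce simp: B'_def)
    then have m1: "measure lborel ((B - K') \<union> ?R) = 2 * measure lborel (B - K')"
      by (simp add: measure_Un3[OF BKf Rf] Rm)
    have "(cell24 \<union> K') \<inter> ((B - K') \<union> ?R) = {}"
      using Bp(1) Kp(1) by (fastforce simp: K'_def)
    then have "measure lborel S = measure lborel (cell24 \<union> K') + measure lborel ((B - K') \<union> ?R)"
      unfolding S by (simp add: measure_Un3 Kf K'f BKf Rf fmeasurable.Un)
    also have "measure lborel (cell24 \<union> K') = 2 * measure lborel cell24 - measure lborel (cell24 \<inter> K')"
      by (simp add: measure_Un3[OF Kf K'f] K'm)
    finally have mS: "measure lborel S = 2 * measure lborel cell24 - measure lborel (cell24 \<inter> K') + 2 * measure lborel (B - K')"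
      using m1 by simp
    have "measure lborel B = measure lborel (B \<inter> K') + measure lborel (B - K')"
    proof -
      have "(B \<inter> K') \<union> (B - K') = B" "(B \<inter> K') \<inter> (B - K') = {}" by auto
      then show ?thesis using measure_Un3[of "B \<inter> K'" lborel "B - K'"] Bf K'f BKf by (simp add: fmeasurable.Int)
    qed
    moreover have "2 * ((T + (2 - p) / 2) * X) = 2 * (T * X) + (2 - p) * X" by (simp add: field_simps)
    ultimately have S16: "16 \<le> measure lborel S" using mS KK BK key K8 by linarith
    show thesis
    proof (rule that[of "cell24 \<union> B"])
      show "16 \<le> measure lborel (cell24 \<union> B \<union> (\<lambda>x. y - x) -` (cell24 \<union> B))"
        using S16 by (simp add: S_def)
      show "norm x < norm (x - v)" if x: "x \<in> cell24 \<union> B" and v: "far_or_root hurwitz_roots v" "2 \<le> norm (v - y)" for x v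
      proof (cases "x \<in> cell24")
        case True then show ?thesis using cell24_closer v by blast
      next
        case False
        have "2 * (1 + T) \<le> t" if t: "2 \<le> t" "v = t *\<^sub>R axis 1 1" for t
        proof -
          have "(2::real)\<^sup>2 \<le> (norm (v - y))\<^sup>2" using v by (intro power_mono) auto
          also have "\<dots> = (t - p)\<^sup>2 + (a\<^sup>2 + (y$3)\<^sup>2 + (y$4)\<^sup>2)"
            by (simp add: norm_vec4 t p_def a_def axis_def)
          \<comment> \<open>The centres \<open>v\<close> and \<open>y\<close> are at least 2 apart,
            and by \<open>qS\<close> the orthogonal part contributes at most
            \<open>p\<^sup>2\<close>.\<close>
          finally have "D\<^sup>2 \<le> (t - p)\<^sup>2" using qS D by simp
          then have "D \<le> t - p" by (rule power2_le_imp_le) (use t p in simp)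
          then show ?thesis using dD unfolding T_def by (simp add: field_simps)
        qed
        then show ?thesis using pyramid_closer[of x T v] False x v T1 by (auto simp: B_def)
      qed
    qed (use Kb Bb norm_cell24 norm_pyramid T1 in \<open>auto simp: B_def\<close>)
  qed
qed

section \<open>Charts adapted to a neighbour\<close>

lemma bij_sorting:
  fixes f :: "4 \<Rightarrow> real"
  obtains \<pi> :: "4 \<Rightarrow> 4" where "bij \<pi>" "f (\<pi> 2) \<le> f (\<pi> 1)" "f (\<pi> 3) \<le> f (\<pi> 2)" "f (\<pi> 4) \<le> f (\<pi> 3)"
proof -
  have ex: "\<exists>i\<in>A. \<forall>j\<in>A. f j \<le> f i" if "A \<noteq> {}" for A :: "4 set"
    using obtains_MAX[of A f] that by (metis Max_ge finite finite_imageI imageI)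
  have ne: "UNIV - A \<noteq> {}" if "card A < 4" for A :: "4 set"
  proof
    assume "UNIV - A = {}"
    then have "A = UNIV" by auto
    then show False using that by simp
  qed
  obtain i where i: "\<And>j. f j \<le> f i" using ex[of UNIV] by auto
  obtain j where j: "j \<noteq> i" "\<And>m. m \<noteq> i \<Longrightarrow> f m \<le> f j"
    using ex[OF ne[of "{i}"]] by auto
  obtain k where k: "k \<noteq> i" "k \<noteq> j" "\<And>m. m \<noteq> i \<Longrightarrow> m \<noteq> j \<Longrightarrow> f m \<le> f k"
    using ex[OF ne[of "{i, j}"]] j(1) by (auto simp: card_insert_if)
  obtain l where l: "l \<noteq> i" "l \<noteq> j" "l \<noteq> k"
    using ex[OF ne[of "{i, j, k}"]] j(1) k(1,2) by (auto simp: card_insert_if)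
  define \<pi> where "\<pi> m = (if m = 1 then i else if m = 2 then j else if m = 3 then k else l)" for m :: 4
  have \<pi>: "\<pi> 1 = i" "\<pi> 2 = j" "\<pi> 3 = k" "\<pi> 4 = l" by (simp_all add: \<pi>_def)
  have "inj \<pi>"
    unfolding inj_def forall_4 \<pi> using j k l by auto
  then have "bij \<pi>" by (simp add: bij_def finite_UNIV_inj_surj)
  then show thesis using that[of \<pi>] i j k l unfolding \<pi> by blast
qed

text \<open>Neither signs nor an order of the two coordinates occur, so invariance under signed
  permutations is immediate.\<close>

definition d4_direction :: "real^4 \<Rightarrow> bool" where
  "d4_direction x \<longleftrightarrow> (\<exists>m n. m \<noteq> n \<and> \<bar>x$m\<bar> = 1 / sqrt 2 \<and> \<bar>x$n\<bar> = 1 / sqrt 2 \<and> (\<forall>i. i \<noteq> m \<longrightarrow> i \<noteq> n \<longrightarrow> x$i = 0))"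

lemma root_directions_eq: "root_directions = Collect d4_direction"
proof (intro set_eqI iffI CollectI)
  fix x assume "x \<in> root_directions"
  then obtain i j s t where ij: "i < j" and st: "s \<in> {1, -1}" "t \<in> {1, -1::real}"
    and x: "x = (s *\<^sub>R axis i 1 + t *\<^sub>R axis j 1) /\<^sub>R sqrt 2"
    by (auto simp: root_directions_def D4_roots_def)
  show "d4_direction x"
    unfolding d4_direction_def
    by (rule exI[of _ i], rule exI[of _ j]) (use ij st in \<open>auto simp: x axis_def field_simps\<close>)
next
  fix x assume "x \<in> Collect d4_direction"
  then obtain m n where mn: "m \<noteq> n" "\<bar>x$m\<bar> = 1 / sqrt 2" "\<bar>x$n\<bar> = 1 / sqrt 2" "\<And>i. i \<noteq> m \<Longrightarrow> i \<noteq> n \<Longrightarrow> x$i = 0"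
    by (auto simp: d4_direction_def)
  have "\<exists>m n. m < n \<and> \<bar>x$m\<bar> = 1 / sqrt 2 \<and> \<bar>x$n\<bar> = 1 / sqrt 2 \<and> (\<forall>i. i \<noteq> m \<longrightarrow> i \<noteq> n \<longrightarrow> x$i = 0)"
  proof (cases "m < n")
    case True then show ?thesis using mn by blast
  next
    case False then have "n < m" using mn(1) by auto
    then show ?thesis using mn by blast
  qed
  then obtain m n where mn: "m < n" "\<bar>x$m\<bar> = 1 / sqrt 2" "\<bar>x$n\<bar> = 1 / sqrt 2" "\<And>i. i \<noteq> m \<Longrightarrow> i \<noteq> n \<Longrightarrow> x$i = 0"
    by blast
  have s: "sqrt 2 * x$i \<in> {1, -1}" if "\<bar>x$i\<bar> = 1 / sqrt 2" for i
  proof -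
    have "x$i = 1 / sqrt 2 \<or> x$i = - (1 / sqrt 2)" using that by linarith
    then show ?thesis by auto
  qed
  have "x = ((sqrt 2 * x$m) *\<^sub>R axis m 1 + (sqrt 2 * x$n) *\<^sub>R axis n 1) /\<^sub>R sqrt 2"
    using mn(1,4) by (auto simp: vec_eq_iff axis_def)
  moreover have "(sqrt 2 * x$m) *\<^sub>R axis m 1 + (sqrt 2 * x$n) *\<^sub>R axis n 1 \<in> D4_roots"
    unfolding D4_roots_def using mn(1) s[OF mn(2)] s[OF mn(3)] by blast
  ultimately show "x \<in> root_directions" unfolding root_directions_def by blast
qed

lemma neg_root_direction: "- x \<in> root_directions \<longleftrightarrow> x \<in> root_directions"
  by (simp add: root_directions_eq d4_direction_def)

text \<open>An orthogonal involution that takes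
  \<open>(axis 1 1 + axis 2 1) /\<^sub>R sqrt 2\<close> to \<open>axis 1 1\<close>.\<close>

definition hurwitz_chart :: "real^4 \<Rightarrow> real^4" where
  "hurwitz_chart x = vec4 ((x$1 + x$2) / sqrt 2) ((x$1 - x$2) / sqrt 2) ((x$3 + x$4) / sqrt 2) ((x$3 - x$4) / sqrt 2)"

lemma orthogonal_transformation_vec4I:
  assumes "\<And>x y. T (x + y) = T x + T y" "\<And>c x. T (c *\<^sub>R x) = c *\<^sub>R T x" "\<And>x. (norm (T x))\<^sup>2 = (norm x)\<^sup>2"
  shows "orthogonal_transformation (T :: real^4 \<Rightarrow> real^4)"
  unfolding orthogonal_transformation using assms by (auto intro: linearI)

lemma orthogonal_transformation_hurwitz_chart: "orthogonal_transformation hurwitz_chart"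
proof (rule orthogonal_transformation_vec4I)
  show "(norm (hurwitz_chart x))\<^sup>2 = (norm x)\<^sup>2" for x
    unfolding norm_vec4 by (simp add: hurwitz_chart_def power_divide power2_eq_square field_simps)
qed (auto simp: hurwitz_chart_def vec4_eq_iff add_divide_distrib diff_divide_distrib algebra_simps)

lemma hurwitz_chart_root: "d4_direction x \<Longrightarrow> hurwitz_chart x \<in> hurwitz_roots"
proof -
  assume "d4_direction x"
  then obtain m n where mn: "m \<noteq> n" "\<bar>x$m\<bar> = 1 / sqrt 2" "\<bar>x$n\<bar> = 1 / sqrt 2" "\<And>i. i \<noteq> m \<Longrightarrow> i \<noteq> n \<Longrightarrow> x$i = 0"
    by (auto simp: d4_direction_def)
  have pm: "(u + v) / sqrt 2 \<in> {1, -1} \<and> (u - v) / sqrt 2 = 0 \<or> (u + v) / sqrt 2 = 0 \<and> (u - v) / sqrt 2 \<in> {1, -1}"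
    if "\<bar>u\<bar> = 1 / sqrt 2" "\<bar>v\<bar> = 1 / sqrt 2" for u v :: real
  proof -
    have "u = 1 / sqrt 2 \<or> u = - (1 / sqrt 2)" "v = 1 / sqrt 2 \<or> v = - (1 / sqrt 2)" using that by linarith+
    then show ?thesis by (auto simp: real_div_sqrt)
  qed
  consider "{m, n} = {1, 2}" | "{m, n} = {3, 4}" | "m \<in> {1, 2} \<and> n \<in> {3, 4} \<or> m \<in> {3, 4} \<and> n \<in> {1, 2}"
    using mn(1) exhaust_4[of m] exhaust_4[of n] by auto
  then show ?thesis
  proof cases
    case 1
    then have u: "\<bar>x$1\<bar> = 1 / sqrt 2" "\<bar>x$2\<bar> = 1 / sqrt 2" using mn by (auto simp: doubleton_eq_iff)
    have z: "x$3 = 0" "x$4 = 0" using 1 mn(4) by (auto simp: doubleton_eq_iff)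
    have "\<exists>i\<in>{1, 2}. hurwitz_chart x = axis i 1 \<or> hurwitz_chart x = - axis i 1"
      using pm[OF u] by (auto simp: hurwitz_chart_def vec4_eq_iff z axis_def)
    then show ?thesis by (auto simp: hurwitz_roots_def)
  next
    case 2
    then have u: "\<bar>x$3\<bar> = 1 / sqrt 2" "\<bar>x$4\<bar> = 1 / sqrt 2" using mn by (auto simp: doubleton_eq_iff)
    have z: "x$1 = 0" "x$2 = 0" using 2 mn(4) by (auto simp: doubleton_eq_iff)
    have "\<exists>i\<in>{3, 4}. hurwitz_chart x = axis i 1 \<or> hurwitz_chart x = - axis i 1"
      using pm[OF u] by (auto simp: hurwitz_chart_def vec4_eq_iff z axis_def)
    then show ?thesis by (auto simp: hurwitz_roots_def)
  next
    case 3
    then have "\<bar>x$1\<bar> = 1 / sqrt 2 \<and> x$2 = 0 \<or> \<bar>x$2\<bar> = 1 / sqrt 2 \<and> x$1 = 0"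
      "\<bar>x$3\<bar> = 1 / sqrt 2 \<and> x$4 = 0 \<or> \<bar>x$4\<bar> = 1 / sqrt 2 \<and> x$3 = 0"
      using mn by auto
    then have "\<forall>i. \<bar>hurwitz_chart x $ i\<bar> = 1/2"
      unfolding forall_4 hurwitz_chart_def vec4_nth by (auto simp: abs_divide real_div_sqrt)
    then show ?thesis by (simp add: hurwitz_roots_def)
  qed
qed

definition swap23 :: "real^4 \<Rightarrow> real^4" where "swap23 x = vec4 (x$1) (x$3) (x$2) (x$4)"

lemma orthogonal_transformation_swap23: "orthogonal_transformation swap23"
  by (rule orthogonal_transformation_vec4I) (auto simp: swap23_def vec4_eq_iff norm_vec4)

lemma swap23_root: "x \<in> hurwitz_roots \<Longrightarrow> swap23 x \<in> hurwitz_roots"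
proof -
  have ax: "swap23 (axis i 1) = axis (if i = 2 then 3 else if i = 3 then 2 else i) 1" for i
    using exhaust_4[of i] by (auto simp: swap23_def vec4_eq_iff axis_def)
  have neg: "swap23 (- x) = - swap23 x" for x by (simp add: swap23_def vec4_eq_iff)
  assume "x \<in> hurwitz_roots"
  then consider i where "x = axis i 1" | i where "x = - axis i 1" | "\<forall>i. \<bar>x$i\<bar> = 1/2"
    by (auto simp: hurwitz_roots_def)
  then show ?thesis
  proof cases
    case 3
    then have "\<forall>i. \<bar>swap23 x$i\<bar> = 1/2" unfolding swap23_def forall_4 by simp
    then show ?thesis by (simp add: hurwitz_roots_def)
  qed (auto simp: hurwitz_roots_def ax neg)
qed

text \<open>A signed permutation makes the coordinates of \<open>y\<close> nonnegative and
  decreasing. The root direction of the first two then has the largest inner product with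
  \<open>y\<close>, and \<open>hurwitz_chart\<close> makes it the first axis. Only the order of the
  second and third coordinates stays open; \<open>swap23\<close> settles it.\<close>

lemma hurwitz_chart_at:
  fixes y :: "real^4"
  obtains T where "orthogonal_transformation T" "\<And>x. x \<in> root_directions \<Longrightarrow> T x \<in> hurwitz_roots"
    "0 \<le> T y$3" "0 \<le> T y$4" "T y$3 \<le> T y$2" "T y$4 \<le> T y$2" "T y$2 + T y$3 + T y$4 \<le> T y$1"
proof -
  obtain \<pi> :: "4 \<Rightarrow> 4" where \<pi>: "bij \<pi>" "\<bar>y$\<pi> 2\<bar> \<le> \<bar>y$\<pi> 1\<bar>" "\<bar>y$\<pi> 3\<bar> \<le> \<bar>y$\<pi> 2\<bar>" "\<bar>y$\<pi> 4\<bar> \<le> \<bar>y$\<pi> 3\<bar>"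
    by (rule bij_sorting[of "\<lambda>i. \<bar>y$i\<bar>"])
  define s where "s i = (if 0 \<le> y$\<pi> i then 1 else -1 :: real)" for i
  define P where "P x = (\<chi> i. s i * x$\<pi> i)" for x :: "real^4"
  have s: "\<bar>s i\<bar> = 1" "s i * s i = 1" for i by (auto simp: s_def)
  have P: "orthogonal_transformation P"
  proof (rule orthogonal_transformation_vec4I)
    fix x :: "real^4"
    have "(norm (P x))\<^sup>2 = (\<Sum>i\<in>UNIV. (x$\<pi> i)\<^sup>2)"
    proof -
      have "P x$i * P x$i = (x$\<pi> i)\<^sup>2" for i
      proof -
        have "P x$i * P x$i = (s i * s i) * (x$\<pi> i)\<^sup>2" by (simp only: P_def vec_lambda_beta power2_eq_square mult_ac)
        then show ?thesis by (simp add: s)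
      qed
      then show ?thesis unfolding power2_norm_eq_inner inner_vec_def by simp
    qed
    also have "\<dots> = (\<Sum>i\<in>UNIV. (x$i)\<^sup>2)"
      using sum.reindex_bij_betw[OF \<pi>(1), of "\<lambda>i. (x$i)\<^sup>2"] by simp
    also have "\<dots> = (norm x)\<^sup>2" unfolding power2_norm_eq_inner inner_vec_def by (simp add: power2_eq_square)
    finally show "(norm (P x))\<^sup>2 = (norm x)\<^sup>2" .
  qed (auto simp: P_def vec_eq_iff algebra_simps)
  have Pr: "d4_direction (P x)" if x: "d4_direction x" for x
  proof -
    obtain m n where mn: "m \<noteq> n" "\<bar>x$m\<bar> = 1 / sqrt 2" "\<bar>x$n\<bar> = 1 / sqrt 2" "\<And>i. i \<noteq> m \<Longrightarrow> i \<noteq> n \<Longrightarrow> x$i = 0"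
      using x by (auto simp: d4_direction_def)
    obtain m' n' where \<pi>': "m = \<pi> m'" "n = \<pi> n'" using \<pi>(1) by (metis bij_pointE)
    have "i = m' \<or> i = n' \<or> \<pi> i \<noteq> m \<and> \<pi> i \<noteq> n" for i
      using \<pi>(1) unfolding \<pi>' by (auto dest: bij_is_inj injD)
    then show ?thesis unfolding d4_direction_def using mn \<pi>'
      by (intro exI[of _ m'] exI[of _ n']) (auto simp: P_def abs_mult s)
  qed
  define T where "T = hurwitz_chart \<circ> P"
  have T: "orthogonal_transformation T"
    unfolding T_def by (rule orthogonal_transformation_compose[OF orthogonal_transformation_hurwitz_chart P])
  have Tr: "T x \<in> hurwitz_roots" if "x \<in> root_directions" for x
    using that by (simp add: T_def root_directions_eq Pr hurwitz_chart_root)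
  have Py: "P y$i = \<bar>y$\<pi> i\<bar>" for i by (simp add: P_def s_def)
  have Ty: "0 \<le> T y$3" "0 \<le> T y$4" "0 \<le> T y$2" "T y$4 \<le> T y$3" "T y$2 + T y$3 + T y$4 \<le> T y$1"
  proof -
    show "0 \<le> T y$3" "0 \<le> T y$4" "0 \<le> T y$2"
      using \<pi> by (simp_all add: T_def hurwitz_chart_def Py)
    show "T y$4 \<le> T y$3" by (simp add: T_def hurwitz_chart_def Py divide_right_mono)
    have "T y$2 + T y$3 + T y$4 = (\<bar>y$\<pi> 1\<bar> - \<bar>y$\<pi> 2\<bar> + 2 * \<bar>y$\<pi> 3\<bar>) / sqrt 2"
      by (simp add: T_def hurwitz_chart_def Py add_divide_distrib diff_divide_distrib)
    also have "\<dots> \<le> (\<bar>y$\<pi> 1\<bar> + \<bar>y$\<pi> 2\<bar>) / sqrt 2" using \<pi>(3) by (intro divide_right_mono) auto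
    finally show "T y$2 + T y$3 + T y$4 \<le> T y$1" by (simp add: T_def hurwitz_chart_def Py)
  qed
  show thesis
  proof (cases "T y$3 \<le> T y$2")
    case True
    then show ?thesis using that[of T] T Tr Ty by auto
  next
    case False
    show ?thesis
    proof (rule that[of "swap23 \<circ> T"])
      show "orthogonal_transformation (swap23 \<circ> T)"
        by (rule orthogonal_transformation_compose[OF orthogonal_transformation_swap23 T])
    qed (use False Ty Tr swap23_root in \<open>auto simp: swap23_def\<close>)
  qed
qed

section \<open>The region of a centre\<close>

lemma far_or_root_chart:
  assumes T: "orthogonal_transformation T" "\<And>x. x \<in> root_directions \<Longrightarrow> T x \<in> hurwitz_roots"
    and z: "far_or_root root_directions z"
  shows "far_or_root hurwitz_roots (T z)"
  using z T(2) orthogonal_transformation_norm[OF T(1)] orthogonal_transformation_scaleR[OF T(1)]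
  unfolding far_or_root_def by metis

lemma orthogonal_diff: "orthogonal_transformation T \<Longrightarrow> T (x - y) = T x - T y"
  by (simp add: orthogonal_transformation_linear linear_diff)

lemma pair_region_D4:
  fixes y :: "real^4"
  assumes ny: "2 \<le> norm y"
  obtains A :: "(real^4) set" where "A \<in> sets borel" "\<And>x. x \<in> A \<Longrightarrow> (norm x)\<^sup>2 < 2"
    "\<And>x z. x \<in> A \<Longrightarrow> far_or_root root_directions z \<Longrightarrow> 2 \<le> norm (z - y) \<Longrightarrow> norm x < norm (x - z)"
    "16 \<le> measure lborel (A \<union> (\<lambda>x. y - x) -` A)"
proof -
  obtain T where T: "orthogonal_transformation T" "\<And>x. x \<in> root_directions \<Longrightarrow> T x \<in> hurwitz_roots"
    "0 \<le> T y$3" "0 \<le> T y$4" "T y$3 \<le> T y$2" "T y$4 \<le> T y$2" "T y$2 + T y$3 + T y$4 \<le> T y$1"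
    by (rule hurwitz_chart_at[of y]) blast
  note nT = orthogonal_transformation_norm[OF T(1)]
  note dT = orthogonal_diff[OF T(1)]
  have "2 \<le> norm (T y)" using ny nT by simp
  then obtain A where A: "A \<in> sets borel" "\<And>x. x \<in> A \<Longrightarrow> (norm x)\<^sup>2 < 2"
    "\<And>x z. x \<in> A \<Longrightarrow> far_or_root hurwitz_roots z \<Longrightarrow> 2 \<le> norm (z - T y) \<Longrightarrow> norm x < norm (x - z)"
    "16 \<le> measure lborel (A \<union> (\<lambda>x. T y - x) -` A)"
    using pair_region[OF T(3-7)] by metis
  have eq: "T -` A \<union> (\<lambda>x. y - x) -` (T -` A) = T -` (A \<union> (\<lambda>x. T y - x) -` A)"
    by (auto simp: dT)
  have b: "A \<union> (\<lambda>x. T y - x) -` A \<in> sets borel" using A(1) emeasure_reflect(1) by auto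
  show thesis
  proof (rule that[of "T -` A"])
    show "T -` A \<in> sets borel" by (rule emeasure_orthogonal_vimage(1)[OF T(1) A(1)])
    show "(norm x)\<^sup>2 < 2" if "x \<in> T -` A" for x using that A(2)[of "T x"] nT by simp
    show "norm x < norm (x - z)" if "x \<in> T -` A" "far_or_root root_directions z" "2 \<le> norm (z - y)" for x z
      using that A(3)[of "T x" "T z"] far_or_root_chart[OF T(1,2)] nT by (simp add: dT[symmetric])
    show "16 \<le> measure lborel (T -` A \<union> (\<lambda>x. y - x) -` (T -` A))"
      unfolding eq using A(4) emeasure_orthogonal_vimage(2)[OF T(1) b] by (simp add: measure_def)
  qed
qed

lemma single_region_D4:
  obtains A :: "(real^4) set" where "A \<in> sets borel" "\<And>x. x \<in> A \<Longrightarrow> (norm x)\<^sup>2 < 2"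
    "\<And>x z. x \<in> A \<Longrightarrow> far_or_root root_directions z \<Longrightarrow> norm x < norm (x - z)"
    "8 \<le> measure lborel A"
proof -
  obtain T where T: "orthogonal_transformation T" "\<And>x. x \<in> root_directions \<Longrightarrow> T x \<in> hurwitz_roots"
    by (rule hurwitz_chart_at[of 0]) blast
  note nT = orthogonal_transformation_norm[OF T(1)]
  have b: "cell24 \<in> sets borel" using open_cell24 by simp
  have f: "cell24 \<in> fmeasurable lborel" using fmeasurable_open_bounded[OF b norm_cell24] .
  have 8: "8 \<le> measure lborel cell24" using emeasure_cell24_ge f by (simp add: emeasure_eq_measure2)
  show thesis
  proof (rule that[of "T -` cell24"])
    show "T -` cell24 \<in> sets borel" by (rule emeasure_orthogonal_vimage(1)[OF T(1) b])
    show "(norm x)\<^sup>2 < 2" if "x \<in> T -` cell24" for x using that norm_cell24[of "T x"] nT by simp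
    show "norm x < norm (x - z)" if "x \<in> T -` cell24" "far_or_root root_directions z" for x z
      using that cell24_closer[of "T x" "T z"] far_or_root_chart[OF T] nT by (simp add: orthogonal_diff[OF T(1), symmetric])
    show "8 \<le> measure lborel (T -` cell24)"
      using 8 emeasure_orthogonal_vimage(2)[OF T(1) b] by (simp add: measure_def)
  qed
qed

lemma measure_vimage_diff:
  fixes A :: "(real^4) set"
  assumes "A \<in> sets borel"
  shows "(\<lambda>x. x - c) -` A \<in> sets borel" "measure lborel ((\<lambda>x. x - c) -` A) = measure lborel A"
proof -
  have b: "(\<lambda>x. 0 - x) -` A \<in> sets borel" by (rule emeasure_reflect(1)[OF assms])
  have eq: "(\<lambda>x. x - c) -` A = (\<lambda>x. c - x) -` ((\<lambda>x. 0 - x) -` A)" by auto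
  show "(\<lambda>x. x - c) -` A \<in> sets borel" unfolding eq by (rule emeasure_reflect(1)[OF b])
  show "measure lborel ((\<lambda>x. x - c) -` A) = measure lborel A"
    unfolding eq measure_def emeasure_reflect(2)[OF b] emeasure_reflect(2)[OF assms] ..
qed

text \<open>The reflection \<open>x \<mapsto> y - x\<close> exchanges the two sides of the bisector
  of 0 and \<open>y\<close>, and the bisector itself is a null set.\<close>

lemma half_of_symmetric_set:
  fixes S :: "(real^4) set"
  assumes S: "S \<in> sets borel" "(\<lambda>x. y - x) -` S = S" and y: "y \<noteq> 0"
  shows "{x \<in> S. norm x < norm (x - y)} \<in> sets borel"
    "measure lborel S \<le> 2 * measure lborel {x \<in> S. norm x < norm (x - y)}"
proof -
  define H where "H = {x \<in> S. norm x < norm (x - y)}"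
  define N where "N = {x. (2 *\<^sub>R y) \<bullet> x = y \<bullet> y}"
  have "{x. norm x < norm (x - y)} \<in> sets borel"
    by (intro borel_open open_Collect_less continuous_intros)
  then show b: "{x \<in> S. norm x < norm (x - y)} \<in> sets borel"
    using S(1) sets.Int[of S borel "{x. norm x < norm (x - y)}"] by (simp add: Int_def)
  then have Hb: "H \<in> sets borel" by (simp add: H_def)
  have N: "N \<in> null_sets lborel" unfolding N_def by (rule hyperplane_null_set) (use y in simp)
  then have SN: "S \<inter> N \<in> null_sets lborel" using S(1) by (intro null_set_Int1) auto
  define H' where "H' = (\<lambda>x. y - x) -` H"
  have H'b: "H' \<in> sets borel" unfolding H'_def by (rule emeasure_reflect(1)[OF Hb])
  have H'm: "measure lborel H' = measure lborel H"
    unfolding H'_def measure_def emeasure_reflect(2)[OF Hb] ..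
  have bis: "x \<in> N" if "norm x = norm (x - y)" for x
  proof -
    have "(norm x)\<^sup>2 = (norm (x - y))\<^sup>2" using that by simp
    then show ?thesis unfolding power2_norm_eq_inner N_def
      by (simp add: inner_diff_left inner_diff_right inner_commute)
  qed
  have "S \<subseteq> H \<union> H' \<union> (S \<inter> N)"
  proof
    fix x assume x: "x \<in> S"
    then have "y - x \<in> S" using S(2) by blast
    then show "x \<in> H \<union> H' \<union> (S \<inter> N)"
      using x bis[of x] by (cases "norm x" "norm (x - y)" rule: linorder_cases) (auto simp: H_def H'_def norm_minus_commute)
  qed
  moreover have "H' \<subseteq> S" "H \<subseteq> S" using S(2) by (auto simp: H_def H'_def)
  ultimately have "S = H \<union> H' \<union> (S \<inter> N)" by blast
  then have "measure lborel S = measure lborel (H \<union> H' \<union> (S \<inter> N))" by simp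
  also have "\<dots> = measure lborel (H \<union> H')"
    using Hb H'b SN by (intro measure_Un_null_set) auto
  also have "\<dots> \<le> measure lborel H + measure lborel H'"
    using Hb H'b by (intro measure_Un_le) auto
  finally show "measure lborel S \<le> 2 * measure lborel {x \<in> S. norm x < norm (x - y)}"
    using H'm by (simp add: H_def)
qed

lemma norm_scaleR_direction: "norm (y - c) *\<^sub>R direction c y = y - c"
  by (cases "y = c") (auto simp: direction_def)

lemma neighbour_far_or_root:
  assumes C: "unit_ball_packing C" "c \<in> C" "z \<in> C" "z \<noteq> c"
    and d: "z \<in> active_neighbours C c \<Longrightarrow> direction c z \<in> root_directions"
  shows "far_or_root root_directions (z - c)"
proof (cases "z \<in> active_neighbours C c")
  case True
  have n: "2 \<le> norm (z - c)" using C by (auto simp: unit_ball_packing_def)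
  then show ?thesis
    unfolding far_or_root_def using n d[OF True] norm_scaleR_direction[of z c, symmetric] by blast
next
  case False
  then have "2 * sqrt 2 \<le> norm (z - c)" using C by (auto simp: active_neighbours_def)
  then have "(2 * sqrt 2)\<^sup>2 \<le> (norm (z - c))\<^sup>2" by (intro power_mono) auto
  then show ?thesis by (simp add: far_or_root_def power_mult_distrib)
qed

text \<open>The single-deviation condition counts directions, whereas the regions need a single
  deviating neighbour. Two active neighbours in one direction would be less than
  \<open>2 * sqrt 2 - 2\<close>, hence less than 1, apart.\<close>

lemma same_direction:
  assumes C: "unit_ball_packing C" and y: "y \<in> active_neighbours C c" and z: "z \<in> active_neighbours C c"
    and c: "c \<in> C" and d: "direction c y = direction c z"
  shows "y = z"
proof (rule ccontr)
  assume "y \<noteq> z"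
  have ny: "2 \<le> norm (y - c)" "norm (y - c) < 2 * sqrt 2" and nz: "2 \<le> norm (z - c)" "norm (z - c) < 2 * sqrt 2"
    using C y z c by (auto simp: unit_ball_packing_def active_neighbours_def)
  have "y - z = (y - c) - (z - c)" by simp
  also have "y - c = norm (y - c) *\<^sub>R direction c y" by (simp only: norm_scaleR_direction)
  also have "z - c = norm (z - c) *\<^sub>R direction c y" by (simp only: d norm_scaleR_direction)
  finally have e: "y - z = (norm (y - c) - norm (z - c)) *\<^sub>R direction c y" by (simp add: scaleR_diff_left)
  have nd: "norm (direction c y) = 1" 
  proof -
    have "y \<noteq> c" using ny by auto
    then show ?thesis by (simp add: direction_def)
  qed
  have "norm (y - z) = norm ((norm (y - c) - norm (z - c)) *\<^sub>R direction c y)"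
    by (rule arg_cong[OF e])
  then have "norm (y - z) = \<bar>norm (y - c) - norm (z - c)\<bar>" by (simp add: nd)
  moreover have "2 \<le> norm (y - z)" using C y z \<open>y \<noteq> z\<close> by (auto simp: unit_ball_packing_def active_neighbours_def)
  moreover have "sqrt 2 < 3/2" by (rule real_less_lsqrt) (auto simp: power2_eq_square)
  ultimately show False using ny nz by linarith
qed

text \<open>\<open>H\<close> is a part of the open Voronoi cell of \<open>c\<close>. Deviation is a
  symmetric relation because root directions are closed under negation, so every third centre is
  \<open>far_or_root\<close> as seen from \<open>c\<close> and from the deviating neighbour
  alike.\<close>

lemma centre_region:
  assumes S: "single_deviation_packing C" and c: "c \<in> C"
  shows "\<exists>H. H \<in> sets borel \<and> H \<subseteq> ball c 2 \<and> 8 \<le> measure lborel H \<and>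
    (\<forall>x\<in>H. \<forall>z\<in>C - {c}. dist x c < dist x z)"
proof -
  have C: "unit_ball_packing C" using S by (simp add: single_deviation_packing_def)
  have uniq: "d = d'" if "c \<in> C" "d \<in> direction c ` active_neighbours C c" "d \<notin> root_directions"
    "d' \<in> direction c ` active_neighbours C c" "d' \<notin> root_directions" for c d d'
    using S that unfolding single_deviation_packing_def Uniq_def by blast
  have ball2: "x \<in> ball 0 2" if "(norm x)\<^sup>2 < 2" for x :: "real^4"
    using power2_less_imp_less[of "norm x" 2] that by simp
  show ?thesis
  proof (cases "\<forall>z\<in>active_neighbours C c. direction c z \<in> root_directions")
    case True
    obtain A :: "(real^4) set" where A: "A \<in> sets borel" "\<And>x. x \<in> A \<Longrightarrow> (norm x)\<^sup>2 < 2"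
      "\<And>x z. x \<in> A \<Longrightarrow> far_or_root root_directions z \<Longrightarrow> norm x < norm (x - z)" "8 \<le> measure lborel A"
      by (rule single_region_D4) blast
    show ?thesis
    proof (intro exI conjI ballI)
      show "(\<lambda>x. x - c) -` A \<in> sets borel" "8 \<le> measure lborel ((\<lambda>x. x - c) -` A)"
        using measure_vimage_diff[OF A(1)] A(4) by auto
      show "(\<lambda>x. x - c) -` A \<subseteq> ball c 2"
      proof
        fix x assume "x \<in> (\<lambda>x. x - c) -` A"
        then show "x \<in> ball c 2" using ball2[OF A(2), of "x - c"] by (simp add: dist_norm norm_minus_commute)
      qed
      fix x z assume x: "x \<in> (\<lambda>x. x - c) -` A" and z: "z \<in> C - {c}"
      have "far_or_root root_directions (z - c)" using neighbour_far_or_root[OF C c] z True by blast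
      then have "norm (x - c) < norm ((x - c) - (z - c))" using A(3) x by blast
      then show "dist x c < dist x z" by (simp add: dist_norm)
    qed
  next
    case False
    then obtain y where y: "y \<in> active_neighbours C c" "direction c y \<notin> root_directions" by blast
    have yC: "y \<in> C" "y \<noteq> c" using y by (auto simp: active_neighbours_def)
    have cy: "c \<in> active_neighbours C y" using y c by (auto simp: active_neighbours_def norm_minus_commute)
    have dy: "direction y c \<notin> root_directions"
    proof -
      have "direction y c = - direction c y"
        by (simp add: direction_def norm_minus_commute scaleR_right_diff_distrib)
      then show ?thesis using y(2) neg_root_direction by simp
    qed
    have far_c: "far_or_root root_directions (z - c)" if "z \<in> C" "z \<noteq> c" "z \<noteq> y" for z
    proof (rule neighbour_far_or_root[OF C c that(1,2)])
      assume z: "z \<in> active_neighbours C c"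
      show "direction c z \<in> root_directions"
      proof (rule ccontr)
        assume "direction c z \<notin> root_directions"
        then have "direction c y = direction c z" using uniq[OF c] y(1) y(2) z by blast
        then show False using same_direction[OF C y(1) z c] that by blast
      qed
    qed
    have far_y: "far_or_root root_directions (z - y)" if "z \<in> C" "z \<noteq> c" "z \<noteq> y" for z
    proof (rule neighbour_far_or_root[OF C yC(1) that(1,3)])
      assume z: "z \<in> active_neighbours C y"
      show "direction y z \<in> root_directions"
      proof (rule ccontr)
        assume "direction y z \<notin> root_directions"
        then have "direction y c = direction y z" using uniq[OF yC(1)] cy dy z by blast
        then show False using same_direction[OF C cy z yC(1)] that by blast
      qed
    qed
    define v where "v = y - c"
    have v2: "2 \<le> norm v" using C yC c by (auto simp: v_def unit_ball_packing_def)
    obtain A :: "(real^4) set" where A: "A \<in> sets borel" "\<And>x. x \<in> A \<Longrightarrow> (norm x)\<^sup>2 < 2"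
      "\<And>x z. x \<in> A \<Longrightarrow> far_or_root root_directions z \<Longrightarrow> 2 \<le> norm (z - v) \<Longrightarrow> norm x < norm (x - z)"
      "16 \<le> measure lborel (A \<union> (\<lambda>x. v - x) -` A)"
      by (rule pair_region_D4[OF v2]) blast
    define U where "U = A \<union> (\<lambda>x. v - x) -` A"
    have U: "U \<in> sets borel" "(\<lambda>x. v - x) -` U = U"
      using A(1) emeasure_reflect(1)[OF A(1), of v] by (auto simp: U_def)
    have v0: "v \<noteq> 0" using v2 by auto
    define H where "H = {x \<in> U. norm x < norm (x - v)}"
    have H: "H \<in> sets borel" "8 \<le> measure lborel H"
      using half_of_symmetric_set[OF U v0] A(4) by (auto simp: H_def U_def)
    show ?thesis
    proof (intro exI conjI ballI)
      show "(\<lambda>x. x - c) -` H \<in> sets borel" "8 \<le> measure lborel ((\<lambda>x. x - c) -` H)"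
        using measure_vimage_diff[OF H(1)] H(2) by auto
      show "(\<lambda>x. x - c) -` H \<subseteq> ball c 2"
      proof
        fix x assume x: "x \<in> (\<lambda>x. x - c) -` H"
        have "x - c \<in> ball 0 2"
        proof (cases "x - c \<in> A")
          case True then show ?thesis using ball2 A(2) by blast
        next
          case False
          \<comment> \<open>A point of the part around \<open>y\<close> is close to
            \<open>y\<close>, and in \<open>H\<close> it is even closer to \<open>c\<close>.\<close>
          then have "v - (x - c) \<in> A" "norm (x - c) < norm (x - c - v)" using x by (auto simp: H_def U_def)
          then show ?thesis using ball2[OF A(2), of "v - (x - c)"] by (simp add: norm_minus_commute)
        qed
        then show "x \<in> ball c 2" by (simp add: dist_norm norm_minus_commute)
      qed
      fix x z assume x: "x \<in> (\<lambda>x. x - c) -` H" and z: "z \<in> C - {c}"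
      define u where "u = x - c"
      have u: "u \<in> U" "norm u < norm (u - v)" using x by (auto simp: H_def u_def)
      have "norm u < norm (u - (z - c))"
      proof (cases "z = y")
        case True then show ?thesis using u by (simp add: v_def)
      next
        case zy: False
        have sep: "2 \<le> norm (z - y)" "2 \<le> norm (z - c)" using C z zy yC c by (auto simp: unit_ball_packing_def)
        show ?thesis
        proof (cases "u \<in> A")
          case True
          have "norm (z - c - v) = norm (z - y)" by (simp add: v_def)
          then show ?thesis using A(3)[OF True far_c[of z]] z zy sep by auto
        next
          case False
          then have w: "v - u \<in> A" using u by (auto simp: U_def)
          \<comment> \<open>For a point in the reflected part the roles of \<open>c\<close> and
            \<open>y\<close> are exchanged: \<open>v - u\<close> is its reflection, and
            \<open>y - z\<close> that of \<open>z\<close>. The region then shows it closer to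
            \<open>y\<close> than to \<open>z\<close>, and it is closer still to
            \<open>c\<close>.\<close>
          have "far_or_root root_directions (y - z)"
          proof -
            have "far_or_root root_directions (z - y)" using far_y z zy by auto
            then show ?thesis unfolding far_or_root_def
            proof (elim disjE exE conjE)
              fix t \<gamma> assume t: "2 \<le> t" "\<gamma> \<in> root_directions" "z - y = t *\<^sub>R \<gamma>"
              have "y - z = - (z - y)" by simp
              then have "y - z = t *\<^sub>R (- \<gamma>)" unfolding t(3) by simp
              then show "8 \<le> (norm (y - z))\<^sup>2 \<or> (\<exists>t \<gamma>. 2 \<le> t \<and> \<gamma> \<in> root_directions \<and> y - z = t *\<^sub>R \<gamma>)"
                using t(1,2) neg_root_direction[of \<gamma>] by blast
            qed (simp add: norm_minus_commute)
          qed
          moreover have "norm (y - z - v) = norm (z - c)" by (simp add: v_def norm_minus_commute)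
          ultimately have "norm (v - u) < norm (v - u - (y - z))" using A(3)[OF w, of "y - z"] sep by simp
          also have "v - u - (y - z) = - (u - (z - c))" by (simp add: v_def)
          finally show ?thesis using u(2) by (simp add: norm_minus_commute)
        qed
      qed
      then show "dist x c < dist x z" by (simp add: dist_norm u_def)
    qed
  qed
qed

section \<open>Density\<close>

lemma measure_ball4:
  fixes c :: "real^4"
  assumes "0 \<le> r"
  shows "measure lborel (ball c r) = pi\<^sup>2 / 2 * r ^ 4" "measure lborel (cball c r) = pi\<^sup>2 / 2 * r ^ 4"
  using content_ball[OF assms, of c] content_cball[OF assms, of c] by (simp_all add: unit_ball_vol_4)

lemma fmeasurable_ball4: "ball (c :: real^4) r \<in> fmeasurable lborel"
  by (intro fmeasurableI emeasure_bounded_finite bounded_ball) simp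

text \<open>Both density estimates compare balls of radii \<open>\<rho> + k\<close> and
  \<open>\<rho>\<close>: \<open>k = 2\<close> for the upper bound, \<open>k = -4\<close> for the
  lattice.\<close>

lemma tendsto_shifted_power_ratio:
  fixes k :: real
  shows "((\<lambda>\<rho>. pi\<^sup>2 / 16 * ((\<rho> + k) / \<rho>) ^ 4) \<longlongrightarrow> pi\<^sup>2 / 16) at_top"
proof -
  have "((\<lambda>\<rho>. pi\<^sup>2 / 16 * (1 + k * inverse \<rho>) ^ 4) \<longlongrightarrow> pi\<^sup>2 / 16 * (1 + k * 0) ^ 4) at_top"
    by (intro tendsto_intros tendsto_inverse_0_at_top filterlim_ident)
  moreover have "\<forall>\<^sub>F \<rho> in at_top. pi\<^sup>2 / 16 * (1 + k * inverse \<rho>) ^ 4 = pi\<^sup>2 / 16 * ((\<rho> + k) / \<rho>) ^ 4"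
    using eventually_gt_at_top[of 0] by eventually_elim (simp add: field_simps)
  ultimately have "((\<lambda>\<rho>. pi\<^sup>2 / 16 * ((\<rho> + k) / \<rho>) ^ 4) \<longlongrightarrow> pi\<^sup>2 / 16 * (1 + k * 0) ^ 4) at_top"
    by (rule Lim_transform_eventually)
  then show ?thesis by simp
qed

lemma single_deviation_count:
  assumes S: "single_deviation_packing C" and \<rho>: "0 \<le> \<rho>"
  shows "8 * real (card {c \<in> C. norm c \<le> \<rho>}) \<le> pi\<^sup>2 / 2 * (\<rho> + 2) ^ 4"
proof (cases "finite {c \<in> C. norm c \<le> \<rho>}")
  case False
  \<comment> \<open>The \<open>card\<close> of an infinite set is 0, so nothing has to be
    counted.\<close>
  then show ?thesis using \<rho> by simp
next
  case True
  define F where "F = {c \<in> C. norm c \<le> \<rho>}"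
  have fin: "finite F" using True by (simp add: F_def)
  obtain H where H: "\<And>c. c \<in> C \<Longrightarrow> H c \<in> sets borel \<and> H c \<subseteq> ball c 2 \<and> 8 \<le> measure lborel (H c) \<and>
    (\<forall>x\<in>H c. \<forall>z\<in>C - {c}. dist x c < dist x z)"
    using centre_region[OF S] by metis
  have HF: "H c \<in> sets lborel" "H c \<subseteq> ball 0 (\<rho> + 2)" "8 \<le> measure lborel (H c)" if "c \<in> F" for c
  proof -
    have c: "c \<in> C" "norm c \<le> \<rho>" using that by (auto simp: F_def)
    show "H c \<in> sets lborel" "8 \<le> measure lborel (H c)" using H[OF c(1)] by auto
    have "ball c 2 \<subseteq> ball 0 (\<rho> + 2)"
    proof
      fix x assume "x \<in> ball c 2"
      then show "x \<in> ball 0 (\<rho> + 2)" using c(2) norm_triangle_ineq[of "x - c" c] by (simp add: dist_norm norm_minus_commute)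
    qed
    then show "H c \<subseteq> ball 0 (\<rho> + 2)" using H[OF c(1)] by blast
  qed
  have fm: "H c \<in> fmeasurable lborel" if "c \<in> F" for c
    by (rule fmeasurableI2[OF fmeasurable_ball4 HF(2,1)[OF that]])
  have disj: "disjoint_family_on H F"
    unfolding disjoint_family_on_def
  proof (intro ballI impI)
    fix c c' assume c: "c \<in> F" "c' \<in> F" "c \<noteq> c'"
    show "H c \<inter> H c' = {}"
    proof (rule ccontr)
      assume "H c \<inter> H c' \<noteq> {}"
      then obtain x where x: "x \<in> H c" "x \<in> H c'" by blast
      have "dist x c < dist x c'" "dist x c' < dist x c"
        using H[of c] H[of c'] c x by (auto simp: F_def)
      then show False by simp
    qed
  qed
  have "8 * real (card F) = (\<Sum>c\<in>F. 8)" by simp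
  also have "\<dots> \<le> (\<Sum>c\<in>F. measure lborel (H c))" using HF(3) by (intro sum_mono) auto
  also have "\<dots> = measure lborel (\<Union>c\<in>F. H c)"
    by (rule measure_finite_Union[symmetric, OF fin _ disj]) (use HF(1) fmeasurableD2[OF fm] in auto)
  also have "\<dots> \<le> measure lborel (ball (0 :: real^4) (\<rho> + 2))"
    using HF fin by (intro measure_mono_fmeasurable fmeasurable_ball4 sets.finite_UN) auto
  also have "\<dots> = pi\<^sup>2 / 2 * (\<rho> + 2) ^ 4" using \<rho> by (intro measure_ball4) simp
  finally show ?thesis by (simp add: F_def)
qed

lemma packing_density_le:
  assumes S: "single_deviation_packing C"
  shows "packing_density C \<le> ereal (pi\<^sup>2 / 16)"
proof -
  have "packing_density C \<le> Limsup at_top (\<lambda>\<rho>. ereal (pi\<^sup>2 / 16 * ((\<rho> + 2) / \<rho>) ^ 4))"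
    unfolding packing_density_def
  proof (rule Limsup_mono)
    show "\<forall>\<^sub>F \<rho> in at_top. ereal (measure lborel (cball (0 :: real^4) 1) * real (card {c \<in> C. norm c \<le> \<rho>})
              / measure lborel (cball (0 :: real^4) \<rho>)) \<le> ereal (pi\<^sup>2 / 16 * ((\<rho> + 2) / \<rho>) ^ 4)"
      using eventually_gt_at_top[of 0]
    proof eventually_elim
      case (elim \<rho>)
      have "real (card {c \<in> C. norm c \<le> \<rho>}) \<le> pi\<^sup>2 / 16 * (\<rho> + 2) ^ 4"
        using single_deviation_count[OF S, of \<rho>] elim by simp
      then have "real (card {c \<in> C. norm c \<le> \<rho>}) / \<rho> ^ 4 \<le> pi\<^sup>2 / 16 * (\<rho> + 2) ^ 4 / \<rho> ^ 4"
        using elim by (intro divide_right_mono) auto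
      then show ?case using elim by (simp add: measure_ball4 power_divide)
    qed
  qed
  also have "\<dots> = ereal (pi\<^sup>2 / 16)"
    by (rule lim_imp_Limsup) (simp_all only: lim_ereal tendsto_shifted_power_ratio trivial_limit_at_top_linorder not_False_eq_True)
  finally show ?thesis .
qed

section \<open>The lattice attains the bound\<close>

abbreviation (input) scaled_D4 :: "(real^4) set" where "scaled_D4 \<equiv> (*\<^sub>R) (sqrt 2) ` D4_lattice"

lemma scaled_D4_iff:
  "x \<in> scaled_D4 \<longleftrightarrow> (\<exists>m :: int^4. even (\<Sum>i\<in>UNIV. m$i) \<and> (\<forall>i. x$i = sqrt 2 * of_int (m$i)))"
proof
  assume "x \<in> scaled_D4"
  then show "\<exists>m :: int^4. even (\<Sum>i\<in>UNIV. m$i) \<and> (\<forall>i. x$i = sqrt 2 * of_int (m$i))"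
    by (auto simp: D4_lattice_def)
next
  assume "\<exists>m :: int^4. even (\<Sum>i\<in>UNIV. m$i) \<and> (\<forall>i. x$i = sqrt 2 * of_int (m$i))"
  then obtain m :: "int^4" where m: "even (\<Sum>i\<in>UNIV. m$i)" "\<And>i. x$i = sqrt 2 * of_int (m$i)" by blast
  have "x = sqrt 2 *\<^sub>R (\<chi> i. of_int (m$i))" by (simp add: vec_eq_iff m)
  then show "x \<in> scaled_D4" using m(1) unfolding D4_lattice_def by blast
qed

lemma scaled_D4_diff:
  assumes "x \<in> scaled_D4" "y \<in> scaled_D4"
  shows "x - y \<in> scaled_D4"
proof -
  obtain m n :: "int^4" where mn: "even (\<Sum>i\<in>UNIV. m$i)" "\<And>i. x$i = sqrt 2 * of_int (m$i)"
    "even (\<Sum>i\<in>UNIV. n$i)" "\<And>i. y$i = sqrt 2 * of_int (n$i)"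
    using assms unfolding scaled_D4_iff by blast
  show ?thesis unfolding scaled_D4_iff
    by (rule exI[of _ "m - n"]) (use mn in \<open>simp add: sum_subtractf right_diff_distrib\<close>)
qed

text \<open>An integer and its square have the same parity, so the squared norm is twice an even
  number, that is, a multiple of 4. Strictly between 0 and 8 only 4 remains, and two coordinates of
  \<open>m\<close> are then 1 or -1.\<close>

lemma scaled_D4_short:
  assumes x: "x \<in> scaled_D4" "x \<noteq> 0"
  shows "2 \<le> norm x" "norm x < 2 * sqrt 2 \<Longrightarrow> x /\<^sub>R norm x \<in> root_directions"
proof -
  obtain m :: "int^4" where m: "even (\<Sum>i\<in>UNIV. m$i)" "\<And>i. x$i = sqrt 2 * of_int (m$i)"
    using x(1) unfolding scaled_D4_iff by blast
  define q where "q = (\<Sum>i\<in>UNIV. (m$i)\<^sup>2)"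
  have nx: "(norm x)\<^sup>2 = 2 * of_int q"
    unfolding power2_norm_eq_inner inner_vec_def q_def
    by (simp add: m(2) power2_eq_square sum_distrib_left mult_ac)
  have "even (q - (\<Sum>i\<in>UNIV. m$i))"
    unfolding q_def sum_subtractf[symmetric] by (intro dvd_sum) (simp add: power2_eq_square)
  then have ev: "even q" using m(1) by simp
  have "q \<noteq> 0" using nx x(2) by auto
  moreover have "0 \<le> q" by (simp add: q_def sum_nonneg)
  ultimately have q2: "2 \<le> q" using ev by presburger
  have "2\<^sup>2 \<le> (norm x)\<^sup>2" unfolding nx using q2 by simp
  then show "2 \<le> norm x" by (rule power2_le_imp_le) simp
  assume "norm x < 2 * sqrt 2"
  then have "(norm x)\<^sup>2 < (2 * sqrt 2)\<^sup>2" by (intro power_strict_mono) auto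
  then have "q < 4" unfolding nx by (simp add: power_mult_distrib)
  then have q: "q = 2" using q2 ev by presburger
  have "(norm x)\<^sup>2 = 2\<^sup>2" using nx q by simp
  then have n2: "norm x = 2" by (simp only: power2_eq_iff_nonneg norm_ge_zero zero_le_numeral)
  have sq: "(m$1)\<^sup>2 + (m$2)\<^sup>2 + (m$3)\<^sup>2 + (m$4)\<^sup>2 = 2" using q by (simp add: q_def sum_4)
  have le1: "\<bar>m$i\<bar> \<le> 1" for i
  proof (rule ccontr)
    assume "\<not> \<bar>m$i\<bar> \<le> 1"
    then have "2\<^sup>2 \<le> \<bar>m$i\<bar>\<^sup>2" by (intro power_mono) auto
    moreover have "(m$i)\<^sup>2 \<le> q" unfolding q_def by (rule member_le_sum) auto
    ultimately show False using q by simp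
  qed
  have sqc: "(m$i)\<^sup>2 = \<bar>m$i\<bar>" "\<bar>m$i\<bar> = 0 \<or> \<bar>m$i\<bar> = 1" for i
  proof -
    have "m$i = -1 \<or> m$i = 0 \<or> m$i = 1" using le1[of i] by arith
    then show "(m$i)\<^sup>2 = \<bar>m$i\<bar>" "\<bar>m$i\<bar> = 0 \<or> \<bar>m$i\<bar> = 1" by auto
  qed
  have xi: "\<bar>(x /\<^sub>R norm x)$i\<bar> = of_int \<bar>m$i\<bar> / sqrt 2" for i
    by (simp add: n2 m(2) abs_mult field_simps)
  have "\<exists>k l. k \<noteq> l \<and> \<bar>m$k\<bar> = 1 \<and> \<bar>m$l\<bar> = 1 \<and> (\<forall>i. i \<noteq> k \<longrightarrow> i \<noteq> l \<longrightarrow> \<bar>m$i\<bar> = 0)"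
  proof -
    have c: "card {i. \<bar>m$i\<bar> = 1} = 2"
    proof -
      have "int (card {i. \<bar>m$i\<bar> = 1}) = (\<Sum>i\<in>UNIV. if \<bar>m$i\<bar> = 1 then 1 else 0)"
        by (simp add: sum.If_cases)
      also have "\<dots> = (\<Sum>i\<in>UNIV. (m$i)\<^sup>2)" using sqc by (intro sum.cong) auto
      also have "\<dots> = 2" using q by (simp add: q_def)
      finally show ?thesis by simp
    qed
    then obtain k l where "{i. \<bar>m$i\<bar> = 1} = {k, l}" "k \<noteq> l" by (meson card_2_iff)
    then show ?thesis using sqc(2) by (intro exI[of _ k] exI[of _ l]) blast
  qed
  then obtain k l where kl: "k \<noteq> l" "\<bar>m$k\<bar> = 1" "\<bar>m$l\<bar> = 1" "\<And>i. i \<noteq> k \<Longrightarrow> i \<noteq> l \<Longrightarrow> \<bar>m$i\<bar> = 0"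
    by blast
  have "(x /\<^sub>R norm x)$i = 0" if "i \<noteq> k" "i \<noteq> l" for i
    using xi[of i] kl(4)[OF that] by simp
  then have "d4_direction (x /\<^sub>R norm x)"
    unfolding d4_direction_def using kl(1-3) xi[of k] xi[of l] by (intro exI[of _ k] exI[of _ l]) simp
  then show "x /\<^sub>R norm x \<in> root_directions" by (simp add: root_directions_eq)
qed

lemma single_deviation_D4: "single_deviation_packing scaled_D4"
  unfolding single_deviation_packing_def
proof (intro conjI ballI)
  show "unit_ball_packing scaled_D4"
    unfolding unit_ball_packing_def using scaled_D4_short(1)[OF scaled_D4_diff] by simp
  fix c assume c: "c \<in> scaled_D4"
  have "direction c z \<in> root_directions" if "z \<in> active_neighbours scaled_D4 c" for z
    using that scaled_D4_short(2)[OF scaled_D4_diff[OF _ c], of z] by (simp add: direction_def active_neighbours_def)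
  then show "\<exists>\<^sub>\<le>\<^sub>1d. d \<in> direction c ` active_neighbours scaled_D4 c \<and> d \<notin> root_directions"
    by (auto simp: Uniq_def)
qed

text \<open>The period lattice is the sublattice of integer multiples of \<open>2 * sqrt 2\<close>,
  whose basis is orthogonal and therefore obviously independent.\<close>

lemma periodic_D4: "periodic scaled_D4"
proof -
  define b where "b = (2 * sqrt 2 :: real)"
  define f where "f i = b *\<^sub>R (axis i 1 :: real^4)" for i
  define L where "L = {\<Sum>v\<in>range f. of_int (k v) *\<^sub>R v | k :: real^4 \<Rightarrow> int. True}"
  have b0: "b \<noteq> 0" by (simp add: b_def)
  have inj: "inj f" by (auto simp: inj_def f_def axis_eq_axis b0)
  have nz: "0 \<notin> range f" by (auto simp: f_def b0 axis_eq_0_iff)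
  have orth: "pairwise orthogonal (range f)"
    by (auto simp: pairwise_def f_def orthogonal_def inner_axis_axis)
  have ind: "independent (range f)" by (rule pairwise_orthogonal_independent[OF orth nz])
  have span: "span (range f) = UNIV"
  proof -
    have "x \<in> span (range f)" for x
    proof -
      have "x = (\<Sum>i\<in>UNIV. (x$i / b) *\<^sub>R f i)"
        unfolding f_def by (simp add: vec_eq_iff b0 axis_def if_distrib cong: if_cong)
      also have "\<dots> \<in> span (range f)"
        by (intro span_sum span_scale span_base) auto
      finally show ?thesis .
    qed
    then show ?thesis by auto
  qed
  have "full_rank_lattice L"
    unfolding full_rank_lattice_def L_def using ind span by blast
  moreover have "(+) v ` scaled_D4 = scaled_D4" if vL: "v \<in> L" for v
  proof -
    obtain k :: "real^4 \<Rightarrow> int" where v: "v = (\<Sum>w\<in>range f. of_int (k w) *\<^sub>R w)" using vL unfolding L_def by blast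
    have "v$j = sqrt 2 * of_int (2 * k (f j))" for j
    proof -
      have "v = (\<Sum>i\<in>UNIV. of_int (k (f i)) *\<^sub>R f i)" unfolding v by (simp add: sum.reindex[OF inj])
      then have "v$j = (\<Sum>i\<in>UNIV. of_int (k (f i)) * (b * axis i 1 $ j))" by (simp add: f_def mult.assoc)
      also have "\<dots> = (\<Sum>i\<in>UNIV. if i = j then of_int (k (f j)) * b else 0)"
        by (intro sum.cong) (auto simp: axis_def)
      finally show ?thesis by (simp add: b_def)
    qed
    then have vD: "v \<in> scaled_D4" unfolding scaled_D4_iff
      by (intro exI[of _ "\<chi> j. 2 * k (f j)"]) (simp add: sum_distrib_left[symmetric])
    have "0 \<in> scaled_D4" using scaled_D4_diff[OF vD vD] by simp
    then have "- v \<in> scaled_D4" using scaled_D4_diff[OF _ vD, of 0] by simp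
    then have plus: "v + x \<in> scaled_D4" if "x \<in> scaled_D4" for x
      using scaled_D4_diff[OF that, of "- v"] by (simp add: add.commute)
    have "x \<in> (+) v ` scaled_D4" if "x \<in> scaled_D4" for x
      by (rule image_eqI[of _ _ "x - v"]) (simp, rule scaled_D4_diff[OF that vD])
    then show ?thesis using plus by blast
  qed
  ultimately show ?thesis unfolding periodic_def by blast
qed

text \<open>Boxes of volume 8, one at each lattice point, cover the space. The points within
  \<open>\<rho>\<close> already suffice for the ball of radius \<open>\<rho> - 4\<close>, because a
  box has diagonal \<open>sqrt 14 \<le> 4\<close>.\<close>

lemma D4_count:
  assumes \<rho>: "4 \<le> \<rho>"
  shows "pi\<^sup>2 / 2 * (\<rho> - 4) ^ 4 \<le> 8 * real (card {c \<in> scaled_D4. norm c \<le> \<rho>})"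
proof -
  define F where "F = {c \<in> scaled_D4. norm c \<le> \<rho>}"
  define w where "w = vec4 (2 * sqrt 2) (sqrt 2) (sqrt 2) (sqrt 2)"
  have fin: "finite F"
  proof (rule finite_subset)
    define I where "I = (\<lambda>k. sqrt 2 * of_int k) ` {- \<lceil>\<rho>\<rceil>..\<lceil>\<rho>\<rceil>}"
    show "F \<subseteq> (\<lambda>(a, b, c, d). vec4 a b c d) ` (I \<times> I \<times> I \<times> I)"
    proof
      fix x assume x: "x \<in> F"
      then obtain m :: "int^4" where m: "\<And>i. x$i = sqrt 2 * of_int (m$i)"
        unfolding F_def mem_Collect_eq scaled_D4_iff by blast
      have "x$i \<in> I" for i
      proof -
        have "\<bar>of_int (m$i)\<bar> \<le> \<bar>x$i\<bar>" unfolding m abs_mult by (simp add: mult_le_cancel_right1)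
        also have "\<dots> \<le> \<rho>" using component_le_norm_cart[of x i] x by (simp add: F_def)
        finally have "m$i \<in> {- \<lceil>\<rho>\<rceil>..\<lceil>\<rho>\<rceil>}" by (simp add: abs_le_iff) linarith
        then show ?thesis unfolding m I_def by blast
      qed
      then have "(x$1, x$2, x$3, x$4) \<in> I \<times> I \<times> I \<times> I" by simp
      moreover have "x = (\<lambda>(a, b, c, d). vec4 a b c d) (x$1, x$2, x$3, x$4)" by (simp add: vec4_eq_iff)
      ultimately show "x \<in> (\<lambda>(a, b, c, d). vec4 a b c d) ` (I \<times> I \<times> I \<times> I)" by (rule rev_image_eqI)
    qed
    show "finite ((\<lambda>(a, b, c, d). vec4 a b c d) ` (I \<times> I \<times> I \<times> I))" by (simp add: I_def)
  qed
  have tile: "measure lborel (cbox c (c + w)) = 8" for c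
  proof -
    have "c \<in> cbox c (c + w)" by (auto simp: mem_box_cart forall_4 w_def)
    then have "measure lborel (cbox c (c + w)) = (\<Prod>i\<in>UNIV. (c + w)$i - c$i)"
      by (intro content_cbox_cart) auto
    also have "\<dots> = (2 * sqrt 2) * (sqrt 2 * (sqrt 2 * sqrt 2))" unfolding UNIV_4 by (simp add: w_def)
    finally show ?thesis by simp
  qed
  have cover: "ball 0 (\<rho> - 4) \<subseteq> (\<Union>c\<in>F. cbox c (c + w))"
  proof
    fix x :: "real^4" assume x: "x \<in> ball 0 (\<rho> - 4)"
    define n where "n i = \<lfloor>x$i / sqrt 2\<rfloor>" for i
    \<comment> \<open>Rounding down may give an odd coordinate sum; one step back along the first
      axis, where the box is twice as long, repairs the parity.\<close>
    define e where "e = (n 1 + n 2 + n 3 + n 4) mod 2"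
    define m :: "int^4" where "m = (\<chi> i. if i = 1 then n 1 - e else n i)"
    define c where "c = (\<chi> i. sqrt 2 * of_int (m$i))"
    have e: "0 \<le> e" "e \<le> 1" by (auto simp: e_def)
    have "even ((n 1 + n 2 + n 3 + n 4) - e)" by (simp add: e_def minus_mod_eq_mult_div)
    then have "even (\<Sum>i\<in>UNIV. m$i)" by (simp add: sum_4 m_def algebra_simps)
    then have cD: "c \<in> scaled_D4" unfolding scaled_D4_iff c_def by auto
    have fl: "sqrt 2 * of_int (n i) \<le> x$i" "x$i \<le> sqrt 2 * of_int (n i) + sqrt 2" for i
    proof -
      have "of_int (n i) \<le> x$i / sqrt 2" "x$i / sqrt 2 \<le> of_int (n i) + 1" unfolding n_def by linarith+
      then show "sqrt 2 * of_int (n i) \<le> x$i" "x$i \<le> sqrt 2 * of_int (n i) + sqrt 2"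
        by (simp_all add: field_simps)
    qed
    define s where "s = sqrt 2 * of_int e"
    have s: "0 \<le> s" "s \<le> sqrt 2" using e by (simp_all add: s_def mult_le_cancel_left1)
    have c: "c$1 = sqrt 2 * of_int (n 1) - s" "c$2 = sqrt 2 * of_int (n 2)"
      "c$3 = sqrt 2 * of_int (n 3)" "c$4 = sqrt 2 * of_int (n 4)"
      by (simp_all add: c_def m_def s_def right_diff_distrib)
    have cw: "c$i \<le> x$i \<and> x$i \<le> c$i + w$i" for i
    proof -
      have "c$1 \<le> x$1 \<and> x$1 \<le> c$1 + w$1" using fl[of 1] s unfolding c w_def vec4_nth by linarith
      moreover have "c$2 \<le> x$2 \<and> x$2 \<le> c$2 + w$2" "c$3 \<le> x$3 \<and> x$3 \<le> c$3 + w$3" "c$4 \<le> x$4 \<and> x$4 \<le> c$4 + w$4"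
        using fl[of 2] fl[of 3] fl[of 4] unfolding c w_def vec4_nth by auto
      ultimately show ?thesis using exhaust_4[of i] by metis
    qed
    have "norm (x - c) \<le> 4"
    proof (rule power2_le_imp_le)
      have "((x - c)$i)\<^sup>2 \<le> (w$i)\<^sup>2" for i using cw[of i] by (intro power_mono) auto
      then have "(norm (x - c))\<^sup>2 \<le> (w$1)\<^sup>2 + (w$2)\<^sup>2 + (w$3)\<^sup>2 + (w$4)\<^sup>2"
        unfolding norm_vec4 by (intro add_mono)
      then show "(norm (x - c))\<^sup>2 \<le> 4\<^sup>2" by (simp add: w_def power_mult_distrib)
    qed simp
    then have "norm c \<le> \<rho>" using x norm_triangle_ineq4[of x "x - c"] by simp
    then have "c \<in> F" using cD by (simp add: F_def)
    moreover have "x \<in> cbox c (c + w)" using cw by (simp add: mem_box_cart)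
    ultimately show "x \<in> (\<Union>c\<in>F. cbox c (c + w))" by blast
  qed
  have "pi\<^sup>2 / 2 * (\<rho> - 4) ^ 4 = measure lborel (ball (0::real^4) (\<rho> - 4))"
    using \<rho> by (intro measure_ball4(1)[symmetric]) simp
  also have "\<dots> \<le> measure lborel (\<Union>c\<in>F. cbox c (c + w))"
    using fin by (intro measure_mono_fmeasurable cover fmeasurable.finite_UN) (auto intro!: fmeasurableI simp: emeasure_lborel_cbox_finite)
  also have "\<dots> \<le> (\<Sum>c\<in>F. measure lborel (cbox c (c + w)))"
    using fin by (intro measure_UNION_le) auto
  also have "\<dots> = 8 * real (card F)" by (simp add: tile)
  finally show ?thesis by (simp add: F_def)
qed

lemma packing_density_D4_ge: "ereal (pi\<^sup>2 / 16) \<le> packing_density scaled_D4"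
proof -
  have "ereal (pi\<^sup>2 / 16) = Limsup at_top (\<lambda>\<rho>. ereal (pi\<^sup>2 / 16 * ((\<rho> + - 4) / \<rho>) ^ 4))"
    by (rule lim_imp_Limsup[symmetric]) (simp_all only: lim_ereal tendsto_shifted_power_ratio trivial_limit_at_top_linorder not_False_eq_True)
  also have "\<dots> \<le> packing_density scaled_D4"
    unfolding packing_density_def
  proof (rule Limsup_mono)
    show "\<forall>\<^sub>F \<rho> in at_top. ereal (pi\<^sup>2 / 16 * ((\<rho> + - 4) / \<rho>) ^ 4) \<le>
        ereal (measure lborel (cball (0 :: real^4) 1) * real (card {c \<in> scaled_D4. norm c \<le> \<rho>})
              / measure lborel (cball (0 :: real^4) \<rho>))"
      using eventually_ge_at_top[of 4]
    proof eventually_elim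
      case (elim \<rho>)
      have "pi\<^sup>2 / 16 * (\<rho> - 4) ^ 4 \<le> real (card {c \<in> scaled_D4. norm c \<le> \<rho>})"
        using D4_count[OF elim] by simp
      then have "pi\<^sup>2 / 16 * (\<rho> - 4) ^ 4 / \<rho> ^ 4 \<le> real (card {c \<in> scaled_D4. norm c \<le> \<rho>}) / \<rho> ^ 4"
        using elim by (intro divide_right_mono) auto
      then show ?case using elim by (simp add: measure_ball4 power_divide)
    qed
  qed
  finally show ?thesis .
qed

theorem corollary1p2:
  shows "(\<forall>C. single_deviation_packing C \<and> periodic C \<longrightarrow>
            packing_density C \<le> ereal (pi\<^sup>2 / 16)) \<and>
         (single_deviation_packing ((*\<^sub>R) (sqrt 2) ` D4_lattice) \<and>
          periodic ((*\<^sub>R) (sqrt 2) ` D4_lattice) \<and>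
          packing_density ((*\<^sub>R) (sqrt 2) ` D4_lattice) = ereal (pi\<^sup>2 / 16)) \<and>
         (\<forall>C. single_deviation_packing C \<longrightarrow>
            packing_density C \<le> ereal (pi\<^sup>2 / 16))"
proof (intro conjI allI impI)
  show "packing_density scaled_D4 = ereal (pi\<^sup>2 / 16)"
    by (rule antisym[OF packing_density_le[OF single_deviation_D4] packing_density_D4_ge])
qed (use packing_density_le single_deviation_D4 periodic_D4 in blast)+

end
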